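(* Let $(\Omega,\mu)$ be a probability space. A random linear operator $A:\Omega\to\mathcal{L}(H^2(S^1))$ is a random Toeplitz operator if and only if its matrix coefficients satisfy $$a_{i+1,j+1}(\omega)=a_{ij}(\omega)$$ for all $\omega\in\Omega$ and all $i,j\ge 0$.
   Context: $S^1$ is the unit circle in $\mathbb{C}$, $L^2(S^1)$ is the Hilbert space of square integrable complex-valued functions on $S^1$ with respect to Lebesgue measure, $e_n(z)=z^n$, and $H^2(S^1)$ is the space of square integrable analytic functions on $S^1$ (the Hardy space, i.e. the closed linear span of $\{e_n:n\ge0\}$ in $L^2(S^1)$). $P:L^2(S^1)\to H^2(S^1)$ is the orthogonal projection. $\mathcal{L}(H)$ is the algebra of bounded linear operators on a Hilbert space $H$. A random linear operator is a map $A:\Omega\to\mathcal{L}(H)$ such that $\omega\mapsto\langle A(\omega)x,y\rangle$ is measurable for all $x,y\in H$. The matrix coefficients of $A:\Omega\to\mathcal{L}(H^2(S^1))$ are $a_{ij}(\omega)=\langle A(\omega)e_j,e_i\rangle$, $i,j\ge0$. $A$ is a random Toeplitz operator if $A=T^\varphi$ for some $\varphi:\Omega\times S^1\to\mathbb{C}$, measurable with respect to the product measure, with $\varphi_\omega:=\varphi(\omega,\cdot)$ bounded for every $\omega\in\Omega$, where $T^\varphi_\omega(u)=P(\varphi_\omega\cdot u)$ for $u\in H^2(S^1)$. *)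

theory Defs
  imports "HOL-Probability.Probability"
begin

section \<open>The circle and its square integrable functions\<close>

text \<open>
  Normalised arc length, so that the functions \<open>z \<mapsto> z ^ n\<close> are orthonormal.  The space of
  this measure is the unit circle, with its Borel sets.
\<close>

definition circle :: "complex measure" where
  "circle = distr (uniform_measure lborel {0..<2 * pi}) (restrict_space borel (sphere 0 1)) cis"

lemma space_circle [simp]: "space circle = sphere 0 1"
  by (simp add: circle_def space_restrict_space)

lemma sets_circle [measurable_cong, simp]: "sets circle = sets (restrict_space borel (sphere 0 1))"
  by (simp add: circle_def)

lemma cis_measurable_circle: "cis \<in> measurable lborel (restrict_space borel (sphere 0 1))"
  by (rule measurable_restrict_space2)
     (auto intro!: borel_measurable_continuous_onI continuous_intros simp: norm_cis)

lemma prob_space_circle: "prob_space circle"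
proof -
  have "prob_space (uniform_measure lborel {0..<2 * pi})"
    by (rule prob_space_uniform_measure) auto
  moreover have "cis \<in> measurable (uniform_measure lborel {0..<2 * pi})
      (restrict_space borel (sphere 0 1))"
    using cis_measurable_circle by (simp cong: measurable_cong_sets)
  ultimately show ?thesis
    unfolding circle_def by (rule prob_space.prob_space_distr)
qed

interpretation circle: prob_space circle
  by (rule prob_space_circle)

definition square_integrable :: "(complex \<Rightarrow> complex) \<Rightarrow> bool" where
  "square_integrable f \<longleftrightarrow>
     f \<in> borel_measurable circle \<and> integrable circle (\<lambda>z. (norm (f z))\<^sup>2)"

lemma square_integrableD:
  assumes "square_integrable f"
  shows "f \<in> borel_measurable circle" "integrable circle (\<lambda>z. (norm (f z))\<^sup>2)"
  using assms by (auto simp: square_integrable_def)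

lemma square_integrable_mult_bounded:
  assumes p: "p \<in> borel_measurable circle" "bounded (p ` space circle)"
    and f: "square_integrable f"
  shows "square_integrable (\<lambda>z. p z * f z)"
proof -
  have [measurable]: "p \<in> borel_measurable circle" "f \<in> borel_measurable circle"
    using p f by (auto dest: square_integrableD)
  from p(2) obtain B where B: "norm (p z) \<le> B" if "z \<in> space circle" for z
    unfolding bounded_iff by blast
  have "integrable circle (\<lambda>z. B\<^sup>2 * (norm (f z))\<^sup>2)"
    using f by (auto dest: square_integrableD)
  then have "integrable circle (\<lambda>z. (norm (p z * f z))\<^sup>2)"
  proof (rule Bochner_Integration.integrable_bound)
    show "AE z in circle. norm ((norm (p z * f z))\<^sup>2) \<le> norm (B\<^sup>2 * (norm (f z))\<^sup>2)"
    proof (rule AE_I2)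
      fix z assume "z \<in> space circle"
      then have "(norm (p z))\<^sup>2 \<le> B\<^sup>2"
        using B by (simp add: power_mono)
      then show "norm ((norm (p z * f z))\<^sup>2) \<le> norm (B\<^sup>2 * (norm (f z))\<^sup>2)"
        by (simp add: norm_mult power_mult_distrib mult_right_mono)
    qed
  qed measurable
  then show ?thesis
    by (simp add: square_integrable_def)
qed

lemma square_integrable_cmult:
  "square_integrable f \<Longrightarrow> square_integrable (\<lambda>z. c * f z)"
  by (rule square_integrable_mult_bounded) (auto simp: bounded_iff)

lemma square_integrable_bounded:
  assumes "p \<in> borel_measurable circle" "bounded (p ` space circle)"
  shows "square_integrable p"
  using square_integrable_mult_bounded[OF assms, of "\<lambda>_. 1"]
  by (simp add: square_integrable_def)

lemma square_integrable_add:
  assumes f: "square_integrable f" and g: "square_integrable g"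
  shows "square_integrable (\<lambda>z. f z + g z)"
proof -
  have [measurable]: "f \<in> borel_measurable circle" "g \<in> borel_measurable circle"
    using f g by (auto dest: square_integrableD)
  have "integrable circle (\<lambda>z. 2 * (norm (f z))\<^sup>2 + 2 * (norm (g z))\<^sup>2)"
    using square_integrableD(2)[OF f] square_integrableD(2)[OF g] by simp
  then have "integrable circle (\<lambda>z. (norm (f z + g z))\<^sup>2)"
  proof (rule Bochner_Integration.integrable_bound)
    show "AE z in circle. norm ((norm (f z + g z))\<^sup>2)
        \<le> norm (2 * (norm (f z))\<^sup>2 + 2 * (norm (g z))\<^sup>2)"
    proof (rule AE_I2)
      fix z
      have "(norm (f z + g z))\<^sup>2 \<le> (norm (f z) + norm (g z))\<^sup>2"
        by (simp add: norm_triangle_ineq power_mono)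
      also have "\<dots> \<le> 2 * (norm (f z))\<^sup>2 + 2 * (norm (g z))\<^sup>2"
        using sum_squares_ge_zero[of "norm (f z) - norm (g z)" 0]
        by (simp add: power2_eq_square algebra_simps)
      finally show "norm ((norm (f z + g z))\<^sup>2)
          \<le> norm (2 * (norm (f z))\<^sup>2 + 2 * (norm (g z))\<^sup>2)"
        by simp
    qed
  qed measurable
  then show ?thesis
    by (simp add: square_integrable_def)
qed

lemma measurable_cnj [measurable (raw)]:
  "f \<in> borel_measurable N \<Longrightarrow> (\<lambda>x. cnj (f x)) \<in> borel_measurable N"
  by (rule measurable_compose[of f N borel cnj borel])
     (auto intro!: borel_measurable_continuous_onI continuous_intros)

lemma integrable_mult_cnj:
  assumes f: "square_integrable f" and g: "square_integrable g"
  shows "integrable circle (\<lambda>z. f z * cnj (g z))"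
proof -
  have [measurable]: "f \<in> borel_measurable circle" "g \<in> borel_measurable circle"
    using f g by (auto dest: square_integrableD)
  have "integrable circle (\<lambda>z. (norm (f z))\<^sup>2 + (norm (g z))\<^sup>2)"
    using f g by (auto dest: square_integrableD)
  then show ?thesis
  proof (rule Bochner_Integration.integrable_bound)
    show "AE z in circle. norm (f z * cnj (g z)) \<le> norm ((norm (f z))\<^sup>2 + (norm (g z))\<^sup>2)"
    proof (rule AE_I2)
      fix z
      have "norm (f z) * norm (g z) \<le> (norm (f z))\<^sup>2 + (norm (g z))\<^sup>2"
        using sum_squares_bound[of "norm (f z)" "norm (g z)"]
          mult_nonneg_nonneg[OF norm_ge_zero[of "f z"] norm_ge_zero[of "g z"]]
        by linarith
      then show "norm (f z * cnj (g z)) \<le> norm ((norm (f z))\<^sup>2 + (norm (g z))\<^sup>2)"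
        by (simp add: norm_mult)
    qed
  qed measurable
qed


section \<open>The Hilbert space of square integrable functions modulo null sets\<close>

quotient_type circle_L2 = "complex \<Rightarrow> complex" / partial:
  "\<lambda>f g. square_integrable f \<and> square_integrable g \<and> (AE z in circle. f z = g z)"
proof (rule part_equivpI)
  show "\<exists>f. square_integrable f \<and> square_integrable f \<and> (AE z in circle. f z = f z)"
    by (rule exI[of _ "\<lambda>_. 0"]) (simp add: square_integrable_def)
  show "symp (\<lambda>f g. square_integrable f \<and> square_integrable g \<and> (AE z in circle. f z = g z))"
    by (auto simp: symp_def elim: AE_mp)
  show "transp (\<lambda>f g. square_integrable f \<and> square_integrable g \<and> (AE z in circle. f z = g z))"
    by (auto simp: transp_def elim: AE_mp)
qed

lemma rep_circle_L2: "square_integrable (rep_circle_L2 u)"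
  using Quotient_rep_reflp[OF Quotient_circle_L2] by simp

lemma rep_abs_circle_L2:
  assumes "square_integrable f"
  shows "AE z in circle. rep_circle_L2 (abs_circle_L2 f) z = f z"
  using Quotient_rep_abs[OF Quotient_circle_L2, of f] assms by simp

instantiation circle_L2 :: ab_group_add
begin

lift_definition zero_circle_L2 :: circle_L2 is "\<lambda>_. 0"
  by (simp add: square_integrable_def)

lift_definition plus_circle_L2 :: "circle_L2 \<Rightarrow> circle_L2 \<Rightarrow> circle_L2" is "\<lambda>f g z. f z + g z"
  by (auto intro: square_integrable_add)

lift_definition uminus_circle_L2 :: "circle_L2 \<Rightarrow> circle_L2" is "\<lambda>f z. - f z"
  using square_integrable_cmult[of _ "-1"] by auto

definition minus_circle_L2 :: "circle_L2 \<Rightarrow> circle_L2 \<Rightarrow> circle_L2" where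
  "minus_circle_L2 f g = f + (- g)"

instance
proof
  fix a b c :: circle_L2
  show "a + b + c = a + (b + c)"
    by transfer (auto simp: add.assoc intro!: square_integrable_add)
  show "a + b = b + a"
    by transfer (auto simp: add.commute intro!: square_integrable_add)
  show "0 + a = a"
    by transfer auto
  show "- a + a = 0"
    by transfer (auto simp: square_integrable_def)
  show "a - b = a + - b"
    by (rule minus_circle_L2_def)
qed

end

lift_definition scaleC_L2 :: "complex \<Rightarrow> circle_L2 \<Rightarrow> circle_L2" is "\<lambda>c f z. c * f z"
  by (auto intro: square_integrable_cmult)

interpretation L2: vector_space scaleC_L2
proof
  fix a b :: complex and x y :: circle_L2
  show "scaleC_L2 a (x + y) = scaleC_L2 a x + scaleC_L2 a y"
    by transfer (auto simp: distrib_left intro!: square_integrable_add square_integrable_cmult)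
  show "scaleC_L2 (a + b) x = scaleC_L2 a x + scaleC_L2 b x"
    by transfer (auto simp: distrib_right intro!: square_integrable_add square_integrable_cmult)
  show "scaleC_L2 a (scaleC_L2 b x) = scaleC_L2 (a * b) x"
    by transfer (auto simp: mult.assoc intro!: square_integrable_cmult)
  show "scaleC_L2 1 x = x"
    by transfer auto
qed

text \<open>The complex inner product is linear in its first argument.\<close>

lift_definition cinner :: "circle_L2 \<Rightarrow> circle_L2 \<Rightarrow> complex" is
  "\<lambda>f g. LINT z|circle. f z * cnj (g z)"
proof -
  fix f f' g g' :: "complex \<Rightarrow> complex"
  assume "square_integrable f \<and> square_integrable f' \<and> (AE z in circle. f z = f' z)"
    and "square_integrable g \<and> square_integrable g' \<and> (AE z in circle. g z = g' z)"
  then show "(LINT z|circle. f z * cnj (g z)) = (LINT z|circle. f' z * cnj (g' z))"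
    by (intro integral_cong_AE)
       (auto dest!: square_integrableD(1) intro!: borel_measurable_times measurable_cnj)
qed

lemma cinner_add_left: "cinner (f + g) h = cinner f h + cinner g h"
  by transfer (simp add: distrib_right integrable_mult_cnj)

lemma cinner_scaleC_left: "cinner (scaleC_L2 c f) h = c * cinner f h"
  by transfer (simp add: mult.assoc)

lemma cinner_commute: "cinner f g = cnj (cinner g f)"
proof transfer
  fix f g :: "complex \<Rightarrow> complex"
  show "(LINT z|circle. f z * cnj (g z)) = cnj (LINT z|circle. g z * cnj (f z))"
    by (simp add: mult.commute flip: Bochner_Integration.integral_cnj)
qed

lemma cinner_self: "cinner f f = of_real (LINT z|circle. (norm (rep_circle_L2 f z))\<^sup>2)"
  by (simp add: cinner.rep_eq complex_norm_square del: of_real_power flip: integral_complex_of_real)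

instantiation circle_L2 :: real_vector
begin

definition scaleR_circle_L2 :: "real \<Rightarrow> circle_L2 \<Rightarrow> circle_L2" where
  "scaleR_circle_L2 r f = scaleC_L2 (of_real r) f"

instance
  by standard
     (simp_all add: scaleR_circle_L2_def L2.scale_right_distrib L2.scale_left_distrib)

end

instantiation circle_L2 :: real_inner
begin

definition inner_circle_L2 :: "circle_L2 \<Rightarrow> circle_L2 \<Rightarrow> real" where
  "inner_circle_L2 f g = Re (cinner f g)"

definition norm_circle_L2 :: "circle_L2 \<Rightarrow> real" where
  "norm_circle_L2 f = sqrt (Re (cinner f f))"

definition sgn_circle_L2 :: "circle_L2 \<Rightarrow> circle_L2" where
  "sgn_circle_L2 f = f /\<^sub>R norm f"

definition dist_circle_L2 :: "circle_L2 \<Rightarrow> circle_L2 \<Rightarrow> real" where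
  "dist_circle_L2 f g = norm (f - g)"

definition uniformity_circle_L2 :: "(circle_L2 \<times> circle_L2) filter" where
  "uniformity_circle_L2 = (INF e\<in>{0 <..}. principal {(x, y). dist x y < e})"

definition open_circle_L2 :: "circle_L2 set \<Rightarrow> bool" where
  "open_circle_L2 U \<longleftrightarrow>
     (\<forall>x\<in>U. eventually (\<lambda>(x', y). x' = x \<longrightarrow> y \<in> U) (uniformity :: (circle_L2 \<times> circle_L2) filter))"

instance
proof
  fix x y z :: circle_L2 and r :: real and U :: "circle_L2 set"
  show "sgn x = x /\<^sub>R norm x"
    by (rule sgn_circle_L2_def)
  show "dist x y = norm (x - y)"
    by (rule dist_circle_L2_def)
  show "(uniformity :: (circle_L2 \<times> circle_L2) filter)
      = (INF e\<in>{0 <..}. principal {(x, y). dist x y < e})"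
    by (rule uniformity_circle_L2_def)
  show "open U \<longleftrightarrow> (\<forall>x\<in>U. eventually (\<lambda>(x', y). x' = x \<longrightarrow> y \<in> U) uniformity)"
    by (rule open_circle_L2_def)
  show "x \<bullet> y = y \<bullet> x"
    by (subst (1 2) inner_circle_L2_def, subst cinner_commute) simp
  show "(x + y) \<bullet> z = x \<bullet> z + y \<bullet> z"
    by (simp add: inner_circle_L2_def cinner_add_left)
  show "(r *\<^sub>R x) \<bullet> y = r * (x \<bullet> y)"
    by (simp add: inner_circle_L2_def scaleR_circle_L2_def cinner_scaleC_left)
  show "0 \<le> x \<bullet> x"
    by (simp add: inner_circle_L2_def cinner_self)
  show "x \<bullet> x = 0 \<longleftrightarrow> x = 0"
  proof
    assume "x \<bullet> x = 0"
    then have "(LINT z|circle. (norm (rep_circle_L2 x z))\<^sup>2) = 0"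
      by (simp add: inner_circle_L2_def cinner_self)
    then have "AE z in circle. rep_circle_L2 x z = 0"
      using square_integrableD(2)[OF rep_circle_L2]
      by (subst (asm) integral_nonneg_eq_0_iff_AE) auto
    then have "abs_circle_L2 (rep_circle_L2 x) = abs_circle_L2 (\<lambda>_. 0)"
      using rep_circle_L2[of x]
      by (intro Quotient_rel_abs[OF Quotient_circle_L2]) (auto simp: square_integrable_def)
    then show "x = 0"
      by (simp add: Quotient_abs_rep[OF Quotient_circle_L2] zero_circle_L2.abs_eq)
  next
    assume "x = 0"
    then show "x \<bullet> x = 0"
      using cinner_scaleC_left[of 0 x x] by (simp add: inner_circle_L2_def)
  qed
  show "norm x = sqrt (x \<bullet> x)"
    by (simp add: norm_circle_L2_def inner_circle_L2_def)
qed

end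

lemma norm_circle_L2_eq: "norm f = sqrt (LINT z|circle. (norm (rep_circle_L2 f z))\<^sup>2)"
  by (simp add: norm_circle_L2_def cinner_self)


section \<open>Hardy space and random Toeplitz operators\<close>

definition basis_L2 :: "nat \<Rightarrow> circle_L2" where
  "basis_L2 n = abs_circle_L2 (\<lambda>z. z ^ n)"

definition H2 :: "circle_L2 set" where
  "H2 = closure (L2.span (range basis_L2))"

definition proj_H2 :: "circle_L2 \<Rightarrow> circle_L2" where
  "proj_H2 f = (THE g. g \<in> H2 \<and> (\<forall>h\<in>H2. cinner (f - g) h = 0))"

text \<open>
  The product of a measurable function that is bounded on the circle with a class in
  \<^typ>\<open>circle_L2\<close>; see the next lemma for the independence of the representative.
\<close>

definition mult_L2 :: "(complex \<Rightarrow> complex) \<Rightarrow> circle_L2 \<Rightarrow> circle_L2" where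
  "mult_L2 p u = abs_circle_L2 (\<lambda>z. p z * rep_circle_L2 u z)"

lemma mult_L2_abs:
  assumes "p \<in> borel_measurable circle" "bounded (p ` space circle)" "square_integrable f"
  shows "mult_L2 p (abs_circle_L2 f) = abs_circle_L2 (\<lambda>z. p z * f z)"
  unfolding mult_L2_def using rep_abs_circle_L2[OF assms(3)] assms
  by (intro Quotient_rel_abs[OF Quotient_circle_L2])
     (auto intro!: square_integrable_mult_bounded rep_circle_L2)

definition toeplitz :: "(complex \<Rightarrow> complex) \<Rightarrow> circle_L2 \<Rightarrow> circle_L2" where
  "toeplitz p u = proj_H2 (mult_L2 p u)"

text \<open>
  Operators on a subspace \<open>H\<close> are functions on the ambient space of which only the values
  on \<open>H\<close> matter.
\<close>

definition bounded_operators :: "circle_L2 set \<Rightarrow> (circle_L2 \<Rightarrow> circle_L2) set" where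
  "bounded_operators H = {T. T \<in> H \<rightarrow> H \<and>
     (\<forall>u\<in>H. \<forall>v\<in>H. T (u + v) = T u + T v) \<and>
     (\<forall>c. \<forall>u\<in>H. T (scaleC_L2 c u) = scaleC_L2 c (T u)) \<and>
     (\<exists>K. \<forall>u\<in>H. norm (T u) \<le> K * norm u)}"

definition random_operator ::
    "'w measure \<Rightarrow> circle_L2 set \<Rightarrow> ('w \<Rightarrow> circle_L2 \<Rightarrow> circle_L2) \<Rightarrow> bool" where
  "random_operator M H A \<longleftrightarrow>
     (\<forall>\<omega>\<in>space M. A \<omega> \<in> bounded_operators H) \<and>
     (\<forall>x\<in>H. \<forall>y\<in>H. (\<lambda>\<omega>. cinner (A \<omega> x) y) \<in> borel_measurable M)"

definition matrix_coeff :: "(circle_L2 \<Rightarrow> circle_L2) \<Rightarrow> nat \<Rightarrow> nat \<Rightarrow> complex" where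
  "matrix_coeff T i j = cinner (T (basis_L2 j)) (basis_L2 i)"

text \<open>
  The circle factor carries its Borel sets.  Measurability for the product sigma-algebra makes
  every section \<open>\<phi> \<omega>\<close> measurable.
\<close>

definition random_toeplitz :: "'w measure \<Rightarrow> ('w \<Rightarrow> circle_L2 \<Rightarrow> circle_L2) \<Rightarrow> bool" where
  "random_toeplitz M A \<longleftrightarrow>
     (\<exists>\<phi> :: 'w \<Rightarrow> complex \<Rightarrow> complex.
        case_prod \<phi> \<in> borel_measurable (M \<Otimes>\<^sub>M circle) \<and>
        (\<forall>\<omega>\<in>space M. bounded (\<phi> \<omega> ` space circle)) \<and>
        (\<forall>\<omega>\<in>space M. \<forall>u\<in>H2. A \<omega> u = toeplitz (\<phi> \<omega>) u))"

end

theory Submission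
  imports Defs
begin

text \<open>
  If the operator \<open>A \<omega>\<close> has matrix \<open>c (i - j)\<close>, the Fejer means of the trigonometric series
  with coefficients \<open>c\<close> are values of the quadratic form of \<open>A \<omega>\<close> at unit vectors, hence bounded
  by its norm.  Their \<open>L\<^sup>2\<close> norms increase, and the squared distance of two of them is at
  most the difference of the squared norms.  So the means converge in \<open>L\<^sup>2\<close>, and almost everywhere along
  indices read off from the squared norms in a way that is measurable in \<open>\<omega>\<close>.  The limit is a
  jointly measurable bounded symbol, and it has the Fourier coefficients \<open>c\<close>.  Conversely, the
  coefficients of a Toeplitz operator are Fourier coefficients of its symbol, once the
  projection onto Hardy space is known to exist, which is where completeness of \<open>L\<^sup>2\<close> enters.
\<close>

section \<open>Fourier modes on the circle\<close>

text \<open>Transport to an interval, where antiderivatives are available. The fundamental theorem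
  of calculus will be applied on the closed interval, whereas the measure is built from the
  half-open one; the endpoint \<open>2 * pi\<close> is a null set.\<close>

lemma integral_circle:
  fixes f :: "complex \<Rightarrow> complex"
  assumes "f \<in> borel_measurable borel"
  shows "(LINT z|circle. f z) = (LINT t|lborel. indicator {0..2*pi} t *\<^sub>R f (cis t)) / (2 * pi)"
proof -
  have m: "f \<in> borel_measurable (restrict_space borel (sphere 0 1))"
    using assms by (rule measurable_restrict_space1)
  have c: "cis \<in> measurable (uniform_measure lborel {0..<2 * pi}) (restrict_space borel (sphere 0 1))"
    using cis_measurable_circle by (simp cong: measurable_cong_sets)
  have [measurable]: "(\<lambda>t. f (cis t)) \<in> borel_measurable borel"
    using measurable_compose[OF cis_measurable_circle m] by simp
  have u: "uniform_measure lborel {0..<2 * pi}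
      = density lborel (\<lambda>t. ennreal (indicator {0..<2*pi} t / (2 * pi)))"
    unfolding uniform_measure_def
    by (rule arg_cong[where f="density lborel"])
       (auto simp: fun_eq_iff divide_ennreal[of 1, simplified] split: split_indicator)
  have "(LINT z|circle. f z) = (LINT t|uniform_measure lborel {0..<2 * pi}. f (cis t))"
    unfolding circle_def by (rule integral_distr[OF c m])
  also have "\<dots> = (LINT t|lborel. (indicator {0..<2*pi} t / (2 * pi)) *\<^sub>R f (cis t))"
    unfolding u by (subst integral_density) auto
  also have "\<dots> = (LINT t|lborel. (indicator {0..2*pi} t *\<^sub>R f (cis t)) / (2 * pi))"
  proof (rule integral_cong_AE)
    have "AE t in lborel. t \<noteq> 2 * pi"
      by (rule AE_lborel_singleton)
    then show "AE t in lborel. (indicator {0..<2*pi} t / (2 * pi)) *\<^sub>R f (cis t)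
        = (indicator {0..2*pi} t *\<^sub>R f (cis t)) / (2 * pi)"
      by eventually_elim (auto split: split_indicator simp: scaleR_conv_of_real)
  qed measurable
  finally show ?thesis by simp
qed

lemma measurable_powi [measurable (raw)]:
  fixes f :: "'a \<Rightarrow> complex"
  assumes [measurable]: "f \<in> borel_measurable N"
  shows "(\<lambda>x. f x powi n) \<in> borel_measurable N"
  unfolding power_int_def by measurable

lemma measurable_ident_circle [measurable]: "(\<lambda>z. z) \<in> borel_measurable circle"
  by (simp add: measurable_restrict_space1 cong: measurable_cong_sets)

lemma norm_powi_circle: "z \<in> sphere 0 1 \<Longrightarrow> norm (z powi n :: complex) = 1"
  by (simp add: norm_power_int)

lemma cnj_powi_circle: "z \<in> sphere 0 1 \<Longrightarrow> cnj (z powi n) = z powi (- n)"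
proof -
  assume "z \<in> sphere 0 1"
  then have "z \<noteq> 0" "cnj z = inverse z"
    using complex_norm_square[of z] inverse_unique[of z "cnj z"] by auto
  then show ?thesis
    by (simp add: power_int_minus power_int_inverse complex_cnj_power_int)
qed

lemma powi_add_circle:
  "z \<in> sphere 0 1 \<Longrightarrow> z powi m * z powi n = (z powi (m + n) :: complex)"
  by (subst power_int_add) auto

text \<open>For \<open>n \<noteq> 0\<close> the antiderivative
  \<open>cis (n * t) / (\<i> * n)\<close> takes equal values at \<open>0\<close> and
  \<open>2 * pi\<close>.\<close>

lemma integral_powi: "(LINT z|circle. z powi n) = of_bool (n = 0)"
proof (cases "n = 0")
  case True
  then show ?thesis using circle.prob_space by simp
next
  case False
  define F where "F t = cis (n * t) / (\<i> * n)" for t :: real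
  have "(LINT t|lborel. indicator {0..2*pi} t *\<^sub>R (cis t powi n)) = F (2 * pi) - F 0"
    unfolding cis_power_int
  proof (rule integral_FTC_Icc)
    fix t :: real
    \<comment> \<open>The derivative is taken in a complex variable and then restricted to the real
      line.\<close>
    have "((\<lambda>z. exp (\<i> * (n * z)) / (\<i> * n)) has_field_derivative cis (n * t)) (at (of_real t))"
      using False
      by (auto intro!: derivative_eq_intros simp: cis_conv_exp)
         (simp add: mult.commute mult.left_commute)
    from has_vector_derivative_real_field[OF this]
    show "(F has_vector_derivative cis (n * t)) (at t within {0..2 * pi})"
      by (simp add: F_def[abs_def] cis_conv_exp)
  qed (auto intro!: continuous_intros)
  also have "cis (n * (2 * pi)) = 1"
    using cis_multiple_2pi[of n] by (simp add: mult_ac)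
  then have "F (2 * pi) - F 0 = 0"
    by (simp add: F_def)
  finally show ?thesis
    using False by (subst integral_circle) auto
qed

lemma integrable_circle_bounded:
  fixes f :: "complex \<Rightarrow> complex"
  assumes "f \<in> borel_measurable circle" "bounded (f ` space circle)"
  shows "integrable circle f"
proof -
  from assms(2) obtain B where "\<And>z. z \<in> space circle \<Longrightarrow> norm (f z) \<le> B"
    unfolding bounded_iff by blast
  then show ?thesis
    by (intro circle.integrable_const_bound[of _ B] AE_I2 assms)
qed

lemma bounded_powi: "bounded ((\<lambda>z::complex. z powi n) ` space circle)"
  unfolding bounded_iff by (auto intro!: exI[of _ 1] simp: norm_power_int)

lemma integrable_powi: "integrable circle (\<lambda>z. z powi n)"
  by (rule integrable_circle_bounded[OF _ bounded_powi]) measurable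

lemma integral_powi_sum_mult_powi:
  fixes c :: "int \<Rightarrow> complex"
  assumes "finite F"
  shows "(LINT z|circle. (\<Sum>n\<in>F. c n * z powi n) * z powi (- m)) = (if m \<in> F then c m else 0)"
proof -
  have "(LINT z|circle. (\<Sum>n\<in>F. c n * z powi n) * z powi (- m))
    = (LINT z|circle. (\<Sum>n\<in>F. c n * z powi (n - m)))"
    by (rule Bochner_Integration.integral_cong)
       (simp_all add: sum_distrib_right mult.assoc powi_add_circle del: power_int_minus)
  also have "\<dots> = (\<Sum>n\<in>F. if n = m then c m else 0)"
    by (subst Bochner_Integration.integral_sum)
       (auto simp: integrable_powi integral_powi intro!: sum.cong)
  finally show ?thesis using assms by simp
qed

lemma square_integrable_powi_sum: "square_integrable (\<lambda>z. \<Sum>n\<in>F. c n * z powi n)"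
proof (cases "finite F")
  case True
  then show ?thesis
  proof (induction F)
    case empty
    then show ?case by (simp add: square_integrable_def)
  next
    case (insert n F)
    then show ?case
      by (simp add: square_integrable_add square_integrable_cmult square_integrable_bounded
          bounded_powi[simplified])
  qed
qed (simp add: square_integrable_def)

text \<open>Parseval's identity for trigonometric polynomials. Only the conjugate factor is
  expanded, so each summand is the extraction of one coefficient by orthogonality of the
  modes.\<close>

lemma integral_norm_powi_sum:
  fixes c :: "int \<Rightarrow> complex"
  assumes F: "finite F"
  shows "(LINT z|circle. (norm (\<Sum>n\<in>F. c n * z powi n))\<^sup>2) = (\<Sum>n\<in>F. (norm (c n))\<^sup>2)"
proof -
  let ?p = "\<lambda>z. \<Sum>n\<in>F. c n * z powi n"
  have i: "integrable circle (\<lambda>z. ?p z * z powi (- m))" for m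
  proof -
    have "square_integrable (\<lambda>z. z powi m)"
      by (rule square_integrable_bounded[OF _ bounded_powi]) measurable
    from integrable_mult_cnj[OF square_integrable_powi_sum[of c F] this] show ?thesis
      by (rule Bochner_Integration.integrable_cong[THEN iffD1, rotated 2])
         (simp_all add: cnj_powi_circle del: complex_cnj_power_int)
  qed
  have "complex_of_real (LINT z|circle. (norm (?p z))\<^sup>2) = (LINT z|circle. ?p z * cnj (?p z))"
    by (simp only: complex_norm_square flip: integral_complex_of_real)
  also have "\<dots> = (LINT z|circle. (\<Sum>m\<in>F. cnj (c m) * (?p z * z powi (- m))))"
    by (rule Bochner_Integration.integral_cong)
       (simp_all add: cnj_powi_circle sum_distrib_left mult_ac del: complex_cnj_power_int)
  also have "\<dots> = (\<Sum>m\<in>F. cnj (c m) * c m)"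
    by (subst Bochner_Integration.integral_sum)
       (auto simp: i integral_powi_sum_mult_powi F intro!: sum.cong simp del: power_int_minus)
  also have "\<dots> = complex_of_real (\<Sum>n\<in>F. (norm (c n))\<^sup>2)"
    by (simp add: complex_norm_square mult.commute del: of_real_power)
  finally show ?thesis
    by (simp only: of_real_eq_iff)
qed

section \<open>Completeness of the space of square integrable functions\<close>

text \<open>Squared \<open>L^2\<close> increments of size \<open>(1/4) ^ k\<close> force
  \<open>L^1\<close> increments of size \<open>(1/2) ^ k\<close>. These have a finite sum, so almost
  everywhere the increments are absolutely summable, and telescoping gives convergence.\<close>

lemma (in prob_space) AE_convergent_of_fast_Cauchy_L2:
  fixes s :: "nat \<Rightarrow> 'a \<Rightarrow> complex"
  assumes [measurable]: "\<And>k. s k \<in> borel_measurable M"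
    and int: "\<And>k. integrable M (\<lambda>x. (norm (s (Suc k) x - s k x))\<^sup>2)"
    and le: "\<And>k. (\<integral>x. (norm (s (Suc k) x - s k x))\<^sup>2 \<partial>M) \<le> (1/4) ^ k"
  shows "AE x in M. convergent (\<lambda>k. s k x)"
proof -
  let ?d = "\<lambda>k x. norm (s (Suc k) x - s k x)"
  have nn: "(\<integral>\<^sup>+x. ennreal (?d k x) \<partial>M) \<le> ennreal ((1/2) ^ k)" for k
  proof -
    \<comment> \<open>Weighted arithmetic-geometric mean inequality: with the weight
      \<open>2 ^ k\<close> each of the two terms in the numerator integrates to at most
      \<open>(1/2) ^ k\<close>.\<close>
    let ?b = "\<lambda>x. ((1/2) ^ k + 2 ^ k * (?d k x)\<^sup>2) / 2"
    have p: "(2::real) ^ k * (1/2) ^ k = 1" "(2::real) ^ k * (1/4) ^ k = (1/2) ^ k"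
      by (simp_all flip: power_mult_distrib)
    have "?d k x \<le> ?b x" for x
    proof -
      have "0 \<le> 2 ^ k * (?d k x - (1/2) ^ k)\<^sup>2"
        by simp
      also have "\<dots> = 2 ^ k * (?d k x)\<^sup>2 - 2 * ?d k x * (2 ^ k * (1/2) ^ k)
          + (2 ^ k * (1/2) ^ k) * (1/2) ^ k"
        by (simp only: power2_diff power2_eq_square algebra_simps)
      finally show ?thesis
        unfolding p by simp
    qed
    then have "(\<integral>\<^sup>+x. ennreal (?d k x) \<partial>M) \<le> (\<integral>\<^sup>+x. ennreal (?b x) \<partial>M)"
      by (intro nn_integral_mono ennreal_leI)
    also have "\<dots> = ennreal (\<integral>x. ?b x \<partial>M)"
      using int[of k] by (intro nn_integral_eq_integral) auto
    also have "(\<integral>x. ?b x \<partial>M) = ((1/2) ^ k + 2 ^ k * (\<integral>x. (?d k x)\<^sup>2 \<partial>M)) / 2"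
      using int[of k] by (simp add: prob_space)
    also have "\<dots> \<le> ((1/2) ^ k + 2 ^ k * (1/4) ^ k) / 2"
      using le[of k] by (intro divide_right_mono add_left_mono mult_left_mono) auto
    finally show ?thesis
      unfolding p by (simp add: ennreal_leI)
  qed
  have "(\<integral>\<^sup>+x. (\<Sum>k. ennreal (?d k x)) \<partial>M) = (\<Sum>k. \<integral>\<^sup>+x. ennreal (?d k x) \<partial>M)"
    by (rule nn_integral_suminf) measurable
  also have "\<dots> \<le> (\<Sum>k. ennreal ((1/2) ^ k))"
    by (intro suminf_le nn) auto
  also have "\<dots> = ennreal (\<Sum>k. (1/2) ^ k)"
    by (intro suminf_ennreal2) (auto intro: summable_geometric)
  finally have "(\<integral>\<^sup>+x. (\<Sum>k. ennreal (?d k x)) \<partial>M) \<noteq> \<infinity>"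
    by (auto simp: top_unique)
  then have "AE x in M. (\<Sum>k. ennreal (?d k x)) \<noteq> \<infinity>"
    by (intro nn_integral_PInf_AE) auto
  then show ?thesis
  proof eventually_elim
    case (elim x)
    then have "summable (\<lambda>k. ?d k x)"
      by (intro summable_suminf_not_top) auto
    then have "summable (\<lambda>k. s (Suc k) x - s k x)"
      by (rule summable_norm_cancel)
    then have "convergent (\<lambda>n. \<Sum>k<n. s (Suc k) x - s k x)"
      by (simp add: summable_iff_convergent)
    then have "convergent (\<lambda>n. s n x - s 0 x)"
      by (simp only: sum_lessThan_telescope[of "\<lambda>k. s k x"])
    from convergent_add[OF this convergent_const[of "s 0 x"]] show ?case
      by simp
  qed
qed

lemma abs_rep_circle_L2: "abs_circle_L2 (rep_circle_L2 u) = u"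
  by (rule Quotient_abs_rep[OF Quotient_circle_L2])

lemma norm_abs_circle_L2:
  assumes "square_integrable f"
  shows "(norm (abs_circle_L2 f))\<^sup>2 = (LINT z|circle. (norm (f z))\<^sup>2)"
proof -
  have [measurable]: "f \<in> borel_measurable circle" "rep_circle_L2 (abs_circle_L2 f) \<in> borel_measurable circle"
    using assms rep_circle_L2 by (auto dest: square_integrableD)
  have "(LINT z|circle. (norm (rep_circle_L2 (abs_circle_L2 f) z))\<^sup>2)
      = (LINT z|circle. (norm (f z))\<^sup>2)"
    using rep_abs_circle_L2[OF assms] by (intro integral_cong_AE) auto
  then show ?thesis
    by (simp add: norm_circle_L2_eq)
qed

lemma square_integrable_diff:
  "square_integrable f \<Longrightarrow> square_integrable g \<Longrightarrow> square_integrable (\<lambda>z. f z - g z)"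
  using square_integrable_add[of f "\<lambda>z. -1 * g z"] square_integrable_cmult[of g "-1"] by simp

lemma abs_circle_L2_diff:
  assumes "square_integrable f" "square_integrable g"
  shows "abs_circle_L2 f - abs_circle_L2 g = abs_circle_L2 (\<lambda>z. f z - g z)"
proof -
  have "square_integrable (\<lambda>z. - g z)"
    using square_integrable_cmult[OF assms(2), of "-1"] by simp
  with assms show ?thesis
    by (simp add: minus_circle_L2_def plus_circle_L2.abs_eq uminus_circle_L2.abs_eq)
qed

lemma norm_diff_circle_L2:
  "(norm (u - v))\<^sup>2 = (LINT z|circle. (norm (rep_circle_L2 u z - rep_circle_L2 v z))\<^sup>2)"
  using norm_abs_circle_L2[OF square_integrable_diff[OF rep_circle_L2 rep_circle_L2], of u v]
    abs_circle_L2_diff[OF rep_circle_L2 rep_circle_L2, of u v]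
  by (simp add: abs_rep_circle_L2)

lemma square_integrable_iff_nn_integral:
  "square_integrable f \<longleftrightarrow> f \<in> borel_measurable circle \<and>
     (\<integral>\<^sup>+z. ennreal ((norm (f z))\<^sup>2) \<partial>circle) < \<infinity>"
  by (auto simp: square_integrable_def integrable_iff_bounded)

text \<open>Fatou's lemma for the squared moduli. One estimate yields both square integrability of
  the limit and the bound on its norm.\<close>

lemma Fatou_circle_L2:
  assumes s: "\<And>k. square_integrable (s k)"
    and le: "\<And>k. (LINT z|circle. (norm (s k z))\<^sup>2) \<le> B"
    and lim: "AE z in circle. (\<lambda>k. s k z) \<longlonglongrightarrow> f z"
    and [measurable]: "f \<in> borel_measurable circle"
  shows "square_integrable f" "(LINT z|circle. (norm (f z))\<^sup>2) \<le> B"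
proof -
  have [measurable]: "s k \<in> borel_measurable circle" for k
    using s by (auto dest: square_integrableD)
  have B: "0 \<le> B"
    using le[of 0] by (rule order_trans[rotated]) simp
  have "(\<integral>\<^sup>+z. ennreal ((norm (f z))\<^sup>2) \<partial>circle)
      = (\<integral>\<^sup>+z. liminf (\<lambda>k. ennreal ((norm (s k z))\<^sup>2)) \<partial>circle)"
  proof (rule nn_integral_cong_AE)
    show "AE z in circle. ennreal ((norm (f z))\<^sup>2) = liminf (\<lambda>k. ennreal ((norm (s k z))\<^sup>2))"
      using lim
    proof eventually_elim
      case (elim z)
      then have "(\<lambda>k. ennreal ((norm (s k z))\<^sup>2)) \<longlonglongrightarrow> ennreal ((norm (f z))\<^sup>2)"
        by (intro tendsto_ennrealI tendsto_power tendsto_norm)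
      then show ?case
        by (rule lim_imp_Liminf[symmetric, rotated]) simp
    qed
  qed
  also have "\<dots> \<le> liminf (\<lambda>k. \<integral>\<^sup>+z. ennreal ((norm (s k z))\<^sup>2) \<partial>circle)"
    by (rule nn_integral_liminf) measurable
  also have "\<dots> \<le> liminf (\<lambda>k. ennreal B)"
  proof (intro Liminf_mono always_eventually allI)
    fix k
    show "(\<integral>\<^sup>+z. ennreal ((norm (s k z))\<^sup>2) \<partial>circle) \<le> ennreal B"
      using le[of k] square_integrableD(2)[OF s[of k]]
      by (subst nn_integral_eq_integral) (auto intro: ennreal_leI)
  qed
  also have "\<dots> = ennreal B"
    by (simp add: Liminf_const)
  finally have *: "(\<integral>\<^sup>+z. ennreal ((norm (f z))\<^sup>2) \<partial>circle) \<le> ennreal B" .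
  then show f: "square_integrable f"
    unfolding square_integrable_iff_nn_integral by (auto simp: top_unique less_top[symmetric])
  from * show "(LINT z|circle. (norm (f z))\<^sup>2) \<le> B"
    using B square_integrableD(2)[OF f] by (subst (asm) nn_integral_eq_integral) auto
qed

text \<open>The Riesz-Fischer argument: a rapidly Cauchy subsequence of representatives converges
  almost everywhere, its limit is also the \<open>L^2\<close> limit, and a Cauchy sequence follows
  any convergent subsequence.\<close>

lemma Cauchy_convergent_circle_L2:
  fixes X :: "nat \<Rightarrow> circle_L2"
  assumes X: "Cauchy X"
  shows "convergent X"
proof -
  have "\<exists>N. \<forall>m\<ge>N. \<forall>n\<ge>N. norm (X m - X n) < (1/2) ^ k" for k :: nat
    using CauchyD[OF X, of "(1/2) ^ k"] by simp
  then have "\<forall>k::nat. \<exists>N. \<forall>m\<ge>N. \<forall>n\<ge>N. norm (X m - X n) < (1/2) ^ k"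
    by (rule allI)
  from choice[OF this] obtain N
    where "\<forall>k. \<forall>m\<ge>N k. \<forall>n\<ge>N k. norm (X m - X n) < (1/2) ^ k" ..
  then have N: "norm (X m - X n) < (1/2) ^ k" if "m \<ge> N k" "n \<ge> N k" for k m n
    using that by blast
  \<comment> \<open>The sum puts \<open>r k\<close> past \<open>N k\<close>, and the summand
    \<open>k\<close> makes \<open>r\<close> strictly increasing.\<close>
  define r where "r k = (\<Sum>i\<le>k. N i) + k" for k
  have r: "strict_mono r"
    by (rule strict_monoI_Suc) (simp add: r_def)
  have rN: "N k \<le> r k" for k
    unfolding r_def by (rule trans_le_add1) (simp add: member_le_sum)
  have d: "norm (X (r m) - X (r k)) \<le> (1/2) ^ k" if "m \<ge> k" for m k
  proof -
    have "r k \<le> r m"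
      using strict_mono_mono[OF r] that by (rule monoD)
    then show ?thesis
      using rN[of k] by (intro less_imp_le[OF N]) (rule order_trans, assumption+)+
  qed
  have p: "((1/2) ^ k)\<^sup>2 = (1/4 :: real) ^ k" for k
    by (simp only: power2_eq_square flip: power_mult_distrib) simp
  define s where "s k = rep_circle_L2 (X (r k))" for k
  have s: "square_integrable (s k)" for k
    unfolding s_def by (rule rep_circle_L2)
  have [measurable]: "s k \<in> borel_measurable circle" for k
    using s by (auto dest: square_integrableD)
  have ds: "(LINT z|circle. (norm (s m z - s k z))\<^sup>2) \<le> (1/4) ^ k" if "m \<ge> k" for m k
  proof -
    have "(norm (X (r m) - X (r k)))\<^sup>2 \<le> ((1/2) ^ k)\<^sup>2"
      using d[OF that] by (intro power_mono) auto
    then show ?thesis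
      unfolding norm_diff_circle_L2 s_def p .
  qed
  have "AE z in circle. convergent (\<lambda>k. s k z)"
    using ds
    by (intro circle.AE_convergent_of_fast_Cauchy_L2 square_integrableD(2) square_integrable_diff s)
       simp_all
  then have lim: "AE z in circle. (\<lambda>k. s k z) \<longlonglongrightarrow> lim (\<lambda>k. s k z)"
    by eventually_elim (rule convergent_LIMSEQ_iff[THEN iffD1])
  define g where "g z = lim (\<lambda>k. s k z)" for z
  have g_meas [measurable]: "g \<in> borel_measurable circle"
    unfolding g_def[abs_def] by measurable
  have diff: "square_integrable (\<lambda>z. g z - s k z)"
    "(LINT z|circle. (norm (g z - s k z))\<^sup>2) \<le> (1/4) ^ k" for k
  proof -
    \<comment> \<open>With \<open>k\<close> fixed and \<open>m\<close> tending to infinity, Fatou's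
      lemma carries the Cauchy estimate over to the distance between \<open>g\<close> and
      \<open>s k\<close>.\<close>
    let ?s = "\<lambda>m z. s (m + k) z - s k z"
    have 1: "square_integrable (?s m)" for m
      by (intro square_integrable_diff s)
    have 2: "(LINT z|circle. (norm (?s m z))\<^sup>2) \<le> (1/4) ^ k" for m
      by (rule ds) simp
    have 3: "AE z in circle. (\<lambda>m. ?s m z) \<longlonglongrightarrow> g z - s k z"
      using lim
    proof eventually_elim
      case (elim z)
      then show ?case
        unfolding g_def by (intro tendsto_diff tendsto_const LIMSEQ_ignore_initial_segment)
    qed
    have 4: "(\<lambda>z. g z - s k z) \<in> borel_measurable circle"
      by measurable
    show "square_integrable (\<lambda>z. g z - s k z)"
      "(LINT z|circle. (norm (g z - s k z))\<^sup>2) \<le> (1/4) ^ k"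
      by (rule Fatou_circle_L2[OF 1 2 3 4])+
  qed
  have g: "square_integrable g"
    using square_integrable_add[OF diff(1)[of 0] s[of 0]] by simp
  have "norm (X (r k) - abs_circle_L2 g) \<le> (1/2) ^ k" for k
  proof (rule power2_le_imp_le)
    have "X (r k) = abs_circle_L2 (s k)"
      by (simp add: s_def abs_rep_circle_L2)
    then have "norm (X (r k) - abs_circle_L2 g) = norm (abs_circle_L2 (\<lambda>z. g z - s k z))"
      by (subst norm_minus_commute) (simp add: abs_circle_L2_diff g s)
    then show "(norm (X (r k) - abs_circle_L2 g))\<^sup>2 \<le> ((1/2) ^ k)\<^sup>2"
      using diff(2)[of k] unfolding p by (simp only: norm_abs_circle_L2[OF diff(1)])
  qed simp
  then have "(\<lambda>k. X (r k) - abs_circle_L2 g) \<longlonglongrightarrow> 0"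
    by (intro Lim_null_comparison[OF always_eventually LIMSEQ_power_zero]) auto
  then have "(X \<circ> r) \<longlonglongrightarrow> abs_circle_L2 g"
    by (simp add: LIM_zero_iff o_def)
  then show ?thesis
    by (rule convergentI[OF Cauchy_converges_subseq[OF X r]])
qed

section \<open>Hardy space and Toeplitz operators with bounded symbols\<close>

lemma cinner_scaleC_right: "cinner u (scaleC_L2 c v) = cnj c * cinner u v"
  by (subst (1 2) cinner_commute) (simp add: cinner_scaleC_left)

lemma norm_scaleC_L2: "norm (scaleC_L2 c u) = norm c * norm u"
proof -
  have "cinner (scaleC_L2 c u) (scaleC_L2 c u) = of_real ((norm c)\<^sup>2) * cinner u u"
    using complex_norm_square[of c]
    by (simp add: cinner_scaleC_left cinner_commute[of u "scaleC_L2 c u"] cinner_commute[of u u, symmetric]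
        mult.assoc del: of_real_power)
  then show ?thesis
    by (simp add: norm_circle_L2_def real_sqrt_mult del: of_real_power)
qed

lemma norm_cinner_le: "norm (cinner u v) \<le> norm u * norm v"
proof (cases "cinner u v = 0")
  case False
  \<comment> \<open>A factor of modulus one that rotates the complex inner product onto the positive
    real axis, where the Cauchy-Schwarz inequality for \<open>inner\<close> applies.\<close>
  define c where "c = cnj (cinner u v) / norm (cinner u v)"
  have c: "norm c = 1"
    using False by (simp add: c_def norm_divide)
  have "cinner (scaleC_L2 c u) v = of_real (norm (cinner u v))"
    using False complex_norm_square[of "cinner u v"]
    by (simp add: cinner_scaleC_left c_def field_simps power2_eq_square)
  then have "norm (cinner u v) = inner (scaleC_L2 c u) v"
    by (simp add: inner_circle_L2_def)
  also have "\<dots> \<le> norm (scaleC_L2 c u) * norm v"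
    by (rule norm_cauchy_schwarz)
  finally show ?thesis
    by (simp add: norm_scaleC_L2 c)
qed simp

lemma cinner_zero_left [simp]: "cinner 0 v = 0"
  using cinner_scaleC_left[of 0 0 v] by simp

lemma cinner_diff_left: "cinner (u - v) w = cinner u w - cinner v w"
  using cinner_add_left[of "u - v" v w] by simp

lemma cinner_sum_left: "cinner (\<Sum>i\<in>I. u i) v = (\<Sum>i\<in>I. cinner (u i) v)"
  by (induction I rule: infinite_finite_induct) (auto simp: cinner_add_left)

lemma cinner_sum_right: "cinner v (\<Sum>i\<in>I. u i) = (\<Sum>i\<in>I. cinner v (u i))"
  by (subst (1 2) cinner_commute) (simp add: cinner_sum_left)

lemma tendsto_cinner_left:
  assumes "(u \<longlongrightarrow> l) F"
  shows "((\<lambda>x. cinner (u x) v) \<longlongrightarrow> cinner l v) F"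
proof (rule LIM_zero_cancel, rule Lim_null_comparison)
  show "\<forall>\<^sub>F x in F. norm (cinner (u x) v - cinner l v) \<le> norm (u x - l) * norm v"
    using norm_cinner_le by (simp flip: cinner_diff_left)
  show "((\<lambda>x. norm (u x - l) * norm v) \<longlongrightarrow> 0) F"
    using assms by (intro tendsto_mult_left_zero tendsto_norm_zero LIM_zero)
qed

lemma tendsto_scaleC_L2:
  assumes "(u \<longlongrightarrow> l) F"
  shows "((\<lambda>x. scaleC_L2 c (u x)) \<longlongrightarrow> scaleC_L2 c l) F"
proof (rule LIM_zero_cancel, rule Lim_null_comparison)
  show "\<forall>\<^sub>F x in F. norm (scaleC_L2 c (u x) - scaleC_L2 c l) \<le> norm c * norm (u x - l)"
    by (simp add: norm_scaleC_L2 flip: L2.scale_right_diff_distrib)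
  show "((\<lambda>x. norm c * norm (u x - l)) \<longlongrightarrow> 0) F"
    using assms by (intro tendsto_mult_right_zero tendsto_norm_zero LIM_zero)
qed

section \<open>Hardy space as a closed complex subspace\<close>

lemma closed_H2: "closed H2"
  by (simp add: H2_def)

lemma span_subset_H2: "L2.span (range basis_L2) \<subseteq> H2"
  by (simp add: H2_def closure_subset)

lemma basis_in_H2 [simp]: "basis_L2 n \<in> H2"
  using span_subset_H2 L2.span_base by blast

lemma subspace_H2: "L2.subspace H2"
proof (rule L2.subspaceI)
  show "0 \<in> H2"
    using span_subset_H2 L2.span_zero by blast
  fix u v assume "u \<in> H2" "v \<in> H2"
  then obtain x y where "\<And>n. x n \<in> L2.span (range basis_L2)" "x \<longlonglongrightarrow> u"
    and "\<And>n. y n \<in> L2.span (range basis_L2)" "y \<longlonglongrightarrow> v"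
    unfolding H2_def closure_sequential by auto
  then have "\<forall>n. x n + y n \<in> L2.span (range basis_L2)" "(\<lambda>n. x n + y n) \<longlonglongrightarrow> u + v"
    by (simp_all add: L2.span_add tendsto_add)
  then show "u + v \<in> H2"
    unfolding H2_def closure_sequential by (intro exI conjI)
next
  fix c u assume "u \<in> H2"
  then obtain x where "\<And>n. x n \<in> L2.span (range basis_L2)" "x \<longlonglongrightarrow> u"
    unfolding H2_def closure_sequential by auto
  then have "\<forall>n. scaleC_L2 c (x n) \<in> L2.span (range basis_L2)"
    "(\<lambda>n. scaleC_L2 c (x n)) \<longlonglongrightarrow> scaleC_L2 c u"
    by (simp_all add: L2.span_scale tendsto_scaleC_L2)
  then show "scaleC_L2 c u \<in> H2"
    unfolding H2_def closure_sequential by (intro exI conjI)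
qed

text \<open>Serves as an induction principle: a condition that cuts out a closed subspace has to be
  checked on the basis only.\<close>

lemma H2_subset:
  assumes "closed S" "L2.subspace S" "\<And>n. basis_L2 n \<in> S"
  shows "H2 \<subseteq> S"
  unfolding H2_def using assms by (intro closure_minimal L2.span_minimal) auto

lemma orthogonal_H2I:
  assumes "\<And>n. cinner u (basis_L2 n) = 0" and "h \<in> H2"
  shows "cinner u h = 0"
proof -
  \<comment> \<open>The vector \<open>h\<close> is moved to the first argument of
    \<open>cinner\<close>, where linearity and continuity are at hand.\<close>
  have "H2 \<subseteq> {h. cinner h u = 0}"
  proof (rule H2_subset)
    show "closed {h. cinner h u = 0}"
      unfolding closed_sequential_limits
    proof safe
      fix x l assume "\<forall>n. x n \<in> {h. cinner h u = 0}" and x: "x \<longlonglongrightarrow> l"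
      with tendsto_cinner_left[OF x, of u] show "cinner l u = 0"
        by (simp add: LIMSEQ_const_iff)
    qed
    show "L2.subspace {h. cinner h u = 0}"
      by (rule L2.subspaceI) (auto simp: cinner_add_left cinner_scaleC_left)
    show "basis_L2 n \<in> {h. cinner h u = 0}" for n
      using assms(1)[of n] by (subst cinner_commute) simp
  qed
  with assms(2) show ?thesis
    by (subst cinner_commute) auto
qed

text \<open>Evaluates the definite description in \<open>proj_H2\<close>. Two candidates differ by
  an element of \<open>H2\<close> that is orthogonal to itself, hence zero.\<close>

lemma proj_H2_eqI:
  assumes g: "g \<in> H2" and orth: "\<And>n. cinner (u - g) (basis_L2 n) = 0"
  shows "proj_H2 u = g"
  unfolding proj_H2_def
proof (rule the_equality)
  show *: "g \<in> H2 \<and> (\<forall>h\<in>H2. cinner (u - g) h = 0)"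
    using orthogonal_H2I[OF orth] g by blast
  fix g' assume g': "g' \<in> H2 \<and> (\<forall>h\<in>H2. cinner (u - g') h = 0)"
  with g have "g' - g \<in> H2"
    using L2.subspace_diff[OF subspace_H2] by blast
  with g' * have "cinner (u - g) (g' - g) - cinner (u - g') (g' - g) = 0"
    by simp
  then have "cinner (g' - g) (g' - g) = 0"
    by (simp flip: cinner_diff_left)
  then have "norm (g' - g) = 0"
    by (simp add: norm_circle_L2_def)
  then show "g' = g"
    by simp
qed

section \<open>Orthonormality of the basis and existence of the projection\<close>

lemma cinner_abs_circle_L2:
  "square_integrable f \<Longrightarrow> square_integrable g \<Longrightarrow>
    cinner (abs_circle_L2 f) (abs_circle_L2 g) = (LINT z|circle. f z * cnj (g z))"
  by (simp add: cinner.abs_eq)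

lemma square_integrable_power: "square_integrable (\<lambda>z. z ^ n)"
  by (rule square_integrable_bounded) (auto simp: bounded_iff norm_power intro!: exI[of _ 1])

lemma power_mult_cnj_circle:
  assumes "z \<in> sphere 0 1"
  shows "z ^ j * cnj (z ^ i) = z powi (int j - int i)"
  using powi_add_circle[OF assms, of "int j" "- int i"] cnj_powi_circle[OF assms, of "int i"]
  by (simp add: power_int_def)

lemma cinner_basis: "cinner (basis_L2 j) (basis_L2 i) = of_bool (j = i)"
proof -
  have "cinner (basis_L2 j) (basis_L2 i) = (LINT z|circle. z powi (int j - int i))"
    unfolding basis_L2_def cinner_abs_circle_L2[OF square_integrable_power square_integrable_power]
    by (intro Bochner_Integration.integral_cong power_mult_cnj_circle) auto
  then show ?thesis
    by (simp add: integral_powi)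
qed

lemma norm_basis_sum:
  assumes "finite F"
  shows "(norm (\<Sum>n\<in>F. scaleC_L2 (c n) (basis_L2 n)))\<^sup>2 = (\<Sum>n\<in>F. (norm (c n))\<^sup>2)"
proof -
  have "norm (basis_L2 n) = 1" for n
    by (simp add: norm_circle_L2_def cinner_basis)
  then show ?thesis
    using assms
    by (subst norm_sum_Pythagorean)
       (auto simp: pairwise_def orthogonal_def inner_circle_L2_def cinner_scaleC_left
          cinner_scaleC_right cinner_basis norm_scaleC_L2)
qed

text \<open>The candidate is the sum of the Fourier series of \<open>u\<close> over the nonnegative
  modes. Bessel's inequality makes the squared coefficients summable, Pythagoras turns this into the
  Cauchy property of the partial sums, and completeness supplies the limit.\<close>

lemma ex_proj_H2: "\<exists>g\<in>H2. \<forall>n. cinner (u - g) (basis_L2 n) = 0"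
proof -
  define c where "c n = cinner u (basis_L2 n)" for n
  define s where "s F = (\<Sum>n\<in>F. scaleC_L2 (c n) (basis_L2 n))" for F
  have ns: "(norm (s F))\<^sup>2 = (\<Sum>n\<in>F. (norm (c n))\<^sup>2)" if "finite F" for F
    unfolding s_def using that by (rule norm_basis_sum)
  \<comment> \<open>The inner product of the partial sum with \<open>u\<close> is the squared norm
    of the partial sum, so the squared distance between the two is the difference of the squared
    norms.\<close>
  have bessel: "(\<Sum>n<N. (norm (c n))\<^sup>2) \<le> (norm u)\<^sup>2" for N
  proof -
    have "cinner (s {..<N}) u = (\<Sum>n<N. c n * cnj (c n))"
      unfolding s_def c_def by (simp add: cinner_sum_left cinner_scaleC_left flip: cinner_commute)
    then have "inner (s {..<N}) u = (norm (s {..<N}))\<^sup>2"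
      by (simp add: inner_circle_L2_def ns complex_norm_square[symmetric] del: of_real_power)
    moreover have "0 \<le> inner (u - s {..<N}) (u - s {..<N})"
      by (rule inner_ge_zero)
    ultimately have "(norm (s {..<N}))\<^sup>2 \<le> (norm u)\<^sup>2"
      by (simp add: inner_diff inner_commute power2_norm_eq_inner)
    then show ?thesis
      by (simp add: ns)
  qed
  have "(\<Sum>n\<le>N. (norm (c n))\<^sup>2) \<le> (norm u)\<^sup>2" for N
    using bessel[of "Suc N"] by (simp only: lessThan_Suc_atMost)
  then have "summable (\<lambda>n. (norm (c n))\<^sup>2)"
    by (rule bounded_imp_summable[rotated]) simp
  then have tail: "\<exists>K. \<forall>m\<ge>K. \<forall>n. norm (\<Sum>i\<in>{m..<n}. (norm (c i))\<^sup>2) < e\<^sup>2" if "e > 0" for e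
    unfolding summable_Cauchy using that by simp
  have "Cauchy (\<lambda>N. s {..<N})"
  proof (rule CauchyI')
    fix e :: real assume e: "e > 0"
    from tail[OF e] obtain K where K: "\<And>m n. m \<ge> K \<Longrightarrow> norm (\<Sum>i\<in>{m..<n}. (norm (c i))\<^sup>2) < e\<^sup>2"
      by blast
    have "norm (s {..<m} - s {..<n}) < e" if "m \<ge> K" "m < n" for m n
    proof -
      have "s {..<m} - s {..<n} = - s {m..<n}"
        using that sum_diff_nat_ivl[of 0 m n "\<lambda>n. scaleC_L2 (c n) (basis_L2 n)"]
        by (simp add: s_def atLeast0LessThan algebra_simps)
      then have "(norm (s {..<m} - s {..<n}))\<^sup>2 < e\<^sup>2"
        using K[OF that(1), of n] by (simp add: ns)
      then show ?thesis
        using e by (simp add: power2_less_imp_less)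
    qed
    then show "\<exists>M. \<forall>m\<ge>M. \<forall>n>m. dist (s {..<m}) (s {..<n}) < e"
      by (auto simp: dist_norm)
  qed
  then obtain g where g: "(\<lambda>N. s {..<N}) \<longlonglongrightarrow> g"
    using Cauchy_convergent_circle_L2 by (auto simp: convergent_def)
  have "s {..<N} \<in> L2.span (range basis_L2)" for N
    unfolding s_def by (intro L2.span_sum L2.span_scale L2.span_base) auto
  with g have "g \<in> H2"
    unfolding H2_def closure_sequential by (intro exI[of _ "\<lambda>N. s {..<N}"]) simp
  moreover have "cinner (u - g) (basis_L2 n) = 0" for n
  proof -
    have "cinner (s {..<N}) (basis_L2 n) = cinner u (basis_L2 n)" if "n < N" for N
      using that by (simp add: s_def cinner_sum_left cinner_scaleC_left cinner_basis c_def)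
    then have "\<forall>\<^sub>F N in sequentially. cinner (s {..<N}) (basis_L2 n) = cinner u (basis_L2 n)"
      by (rule eventually_mono[OF eventually_gt_at_top[of n]])
    then have "(\<lambda>N. cinner (s {..<N}) (basis_L2 n)) \<longlonglongrightarrow> cinner u (basis_L2 n)"
      by (rule tendsto_eventually)
    with tendsto_cinner_left[OF g] have "cinner g (basis_L2 n) = cinner u (basis_L2 n)"
      by (rule LIMSEQ_unique)
    then show ?thesis
      by (simp add: cinner_diff_left)
  qed
  ultimately show ?thesis by blast
qed

lemma cinner_proj_H2_basis: "cinner (proj_H2 u) (basis_L2 n) = cinner u (basis_L2 n)"
proof -
  obtain g where g: "g \<in> H2" "\<And>n. cinner (u - g) (basis_L2 n) = 0"
    using ex_proj_H2 by blast
  then have "proj_H2 u = g"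
    by (rule proj_H2_eqI)
  with g(2)[of n] show ?thesis
    by (simp add: cinner_diff_left)
qed

section \<open>Multiplication and Toeplitz operators with a fixed bounded symbol\<close>

context
  fixes p :: "complex \<Rightarrow> complex"
  assumes p: "p \<in> borel_measurable circle" "bounded (p ` space circle)"
begin

lemma mult_L2_add: "mult_L2 p (u + v) = mult_L2 p u + mult_L2 p v"
proof -
  have "u + v = abs_circle_L2 (\<lambda>z. rep_circle_L2 u z + rep_circle_L2 v z)"
    using plus_circle_L2.abs_eq[of "rep_circle_L2 u" "rep_circle_L2 v"]
    by (simp add: rep_circle_L2 abs_rep_circle_L2)
  then have "mult_L2 p (u + v) = abs_circle_L2 (\<lambda>z. p z * (rep_circle_L2 u z + rep_circle_L2 v z))"
    by (simp only: mult_L2_abs[OF p square_integrable_add[OF rep_circle_L2 rep_circle_L2]])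
  also have "\<dots> = mult_L2 p u + mult_L2 p v"
    unfolding mult_L2_def
    by (subst plus_circle_L2.abs_eq)
       (auto simp: rep_circle_L2 distrib_left intro!: square_integrable_mult_bounded[OF p])
  finally show ?thesis .
qed

lemma mult_L2_scaleC: "mult_L2 p (scaleC_L2 c u) = scaleC_L2 c (mult_L2 p u)"
proof -
  have "scaleC_L2 c u = abs_circle_L2 (\<lambda>z. c * rep_circle_L2 u z)"
    using scaleC_L2.abs_eq[of "rep_circle_L2 u" c] by (simp add: rep_circle_L2 abs_rep_circle_L2)
  then have "mult_L2 p (scaleC_L2 c u) = abs_circle_L2 (\<lambda>z. p z * (c * rep_circle_L2 u z))"
    by (simp only: mult_L2_abs[OF p square_integrable_cmult[OF rep_circle_L2]])
  also have "\<dots> = scaleC_L2 c (mult_L2 p u)"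
    unfolding mult_L2_def
    by (subst scaleC_L2.abs_eq)
       (auto simp: rep_circle_L2 mult_ac intro!: square_integrable_mult_bounded[OF p])
  finally show ?thesis .
qed

lemma norm_mult_L2_le:
  obtains B where "\<And>u. norm (mult_L2 p u) \<le> B * norm u"
proof -
  from p(2) obtain B where B: "\<And>z. z \<in> space circle \<Longrightarrow> norm (p z) \<le> B"
    unfolding bounded_iff by blast
  have B0: "B \<ge> 0"
    using B[of 1] norm_ge_zero[of "p 1"] by (simp del: norm_ge_zero)
  have "norm (mult_L2 p u) \<le> B * norm u" for u
  proof (rule power2_le_imp_le)
    let ?u = "rep_circle_L2 u"
    have i: "integrable circle (\<lambda>z. (norm (?u z))\<^sup>2)" "integrable circle (\<lambda>z. (norm (p z * ?u z))\<^sup>2)"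
      using rep_circle_L2 square_integrable_mult_bounded[OF p rep_circle_L2]
      by (auto intro!: square_integrableD(2))
    have "(norm (mult_L2 p u))\<^sup>2 = (LINT z|circle. (norm (p z * ?u z))\<^sup>2)"
      unfolding mult_L2_def by (intro norm_abs_circle_L2 square_integrable_mult_bounded p rep_circle_L2)
    also have "\<dots> \<le> (LINT z|circle. B\<^sup>2 * (norm (?u z))\<^sup>2)"
      using i B by (intro integral_mono) (auto simp: norm_mult power_mult_distrib intro!: mult_right_mono power_mono)
    also have "\<dots> = (B * norm u)\<^sup>2"
      by (simp add: norm_circle_L2_eq power_mult_distrib)
    finally show "(norm (mult_L2 p u))\<^sup>2 \<le> (B * norm u)\<^sup>2" .
  qed (simp add: B0)
  then show ?thesis by (rule that)
qed

lemma cinner_mult_L2_basis: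
  "cinner (mult_L2 p (basis_L2 j)) (basis_L2 i) = (LINT z|circle. p z * z powi (int j - int i))"
  unfolding basis_L2_def mult_L2_abs[OF p square_integrable_power]
  by (subst cinner_abs_circle_L2)
     (auto intro!: square_integrable_mult_bounded[OF p] square_integrable_power Bochner_Integration.integral_cong
       simp: mult.assoc power_mult_cnj_circle[simplified])

text \<open>Projecting onto \<open>H2\<close> leaves inner products with basis vectors unchanged, so
  a Fourier coefficient of the symbol remains. It depends only on the difference of the indices,
  which gives the forward direction of the theorem.\<close>

lemma matrix_coeff_toeplitz:
  "matrix_coeff (toeplitz p) i j = (LINT z|circle. p z * z powi (int j - int i))"
  by (simp add: matrix_coeff_def toeplitz_def cinner_proj_H2_basis cinner_mult_L2_basis)

text \<open>A bounded operator on \<open>H2\<close> is determined by its matrix. Here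
  \<open>mult_L2 p u - T u\<close> is shown to be orthogonal to every basis vector; as
  \<open>T u\<close> lies in \<open>H2\<close>, this makes it the projection of
  \<open>mult_L2 p u\<close>.\<close>

lemma toeplitz_eqI:
  assumes T: "T \<in> bounded_operators H2"
    and coeff: "\<And>i j. matrix_coeff T i j = (LINT z|circle. p z * z powi (int j - int i))"
    and u: "u \<in> H2"
  shows "toeplitz p u = T u"
proof -
  have TH: "\<And>u. u \<in> H2 \<Longrightarrow> T u \<in> H2"
    and T_add: "\<And>u v. u \<in> H2 \<Longrightarrow> v \<in> H2 \<Longrightarrow> T (u + v) = T u + T v"
    and T_scale: "\<And>c u. u \<in> H2 \<Longrightarrow> T (scaleC_L2 c u) = scaleC_L2 c (T u)"
    using T by (auto simp: bounded_operators_def)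
  have "\<exists>K. \<forall>u\<in>H2. norm (T u) \<le> K * norm u"
    using T by (simp add: bounded_operators_def)
  then obtain K where "\<forall>u\<in>H2. norm (T u) \<le> K * norm u" ..
  then have T_le: "\<And>u. u \<in> H2 \<Longrightarrow> norm (T u) \<le> K * norm u"
    by blast
  obtain B where B: "\<And>u. norm (mult_L2 p u) \<le> B * norm u"
    using norm_mult_L2_le by blast
  define D where "D u = mult_L2 p u - T u" for u
  have D_add: "D (u + v) = D u + D v" if "u \<in> H2" "v \<in> H2" for u v
    using that by (simp add: D_def mult_L2_add T_add)
  have D_scale: "D (scaleC_L2 c u) = scaleC_L2 c (D u)" if "u \<in> H2" for c u
    using that by (simp add: D_def mult_L2_scaleC T_scale L2.scale_right_diff_distrib)
  have D_le: "norm (D u) \<le> (B + K) * norm u" if "u \<in> H2" for u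
    using norm_triangle_ineq4[of "mult_L2 p u" "T u"] B[of u] T_le[OF that]
    by (simp add: D_def algebra_simps)
  have D_lim: "(\<lambda>n. D (x n)) \<longlonglongrightarrow> D l" if x: "\<And>n. x n \<in> H2" "x \<longlonglongrightarrow> l" for x l
  proof -
    have l: "l \<in> H2"
      using closed_H2 x by (rule closed_sequentially)
    have d: "x n - l \<in> H2" for n
      using L2.subspace_diff[OF subspace_H2 x(1) l] .
    have "D (x n) - D l = D (x n - l)" for n
      using D_add[OF d l, of n] by simp
    then have "norm (D (x n) - D l) \<le> (B + K) * norm (x n - l)" for n
      using D_le[OF d] by simp
    then have "\<forall>\<^sub>F n in sequentially. norm (D (x n) - D l) \<le> (B + K) * norm (x n - l)"
      by simp
    moreover have "(\<lambda>n. (B + K) * norm (x n - l)) \<longlonglongrightarrow> 0"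
      using x(2) by (intro tendsto_mult_right_zero tendsto_norm_zero LIM_zero)
    ultimately show ?thesis
      by (rule LIM_zero_cancel[OF Lim_null_comparison])
  qed
  have "cinner (D u) (basis_L2 i) = 0" for i
  proof -
    \<comment> \<open>Membership in \<open>H2\<close> is part of the set because linearity and
      boundedness of \<open>T\<close>, and hence of \<open>D\<close>, are known only there.\<close>
    have "H2 \<subseteq> {u \<in> H2. cinner (D u) (basis_L2 i) = 0}"
    proof (rule H2_subset)
      show "closed {u \<in> H2. cinner (D u) (basis_L2 i) = 0}"
        unfolding closed_sequential_limits
      proof safe
        fix x l assume mem: "\<forall>n. x n \<in> {u \<in> H2. cinner (D u) (basis_L2 i) = 0}" and x: "x \<longlonglongrightarrow> l"
        have H: "x n \<in> H2" for n
          using mem by blast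
        show "l \<in> H2"
          using closed_H2 H x by (rule closed_sequentially)
        show "cinner (D l) (basis_L2 i) = 0"
          using tendsto_cinner_left[OF D_lim[OF H x], of "basis_L2 i"] mem
          by (simp add: LIMSEQ_const_iff)
      qed
      have "D 0 = 0"
        using D_scale[of 0 0] L2.subspace_0[OF subspace_H2] by simp
      then show "L2.subspace {u \<in> H2. cinner (D u) (basis_L2 i) = 0}"
        using subspace_H2
        by (auto simp: L2.subspace_def D_add D_scale cinner_add_left cinner_scaleC_left)
      show "basis_L2 n \<in> {u \<in> H2. cinner (D u) (basis_L2 i) = 0}" for n
        using coeff[of i n] by (simp add: D_def cinner_diff_left cinner_mult_L2_basis matrix_coeff_def)
    qed
    with u show ?thesis by auto
  qed
  then show ?thesis
    unfolding toeplitz_def by (intro proj_H2_eqI TH u) (simp add: D_def)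
qed

end

section \<open>Recovering the symbol from the Fourier coefficients\<close>

text \<open>The truncation at zero makes the weight vanish for \<open>\<bar>n\<bar> > N\<close>, so
  that sums of different lengths can be compared over one index range.\<close>

definition fejer_weight :: "nat \<Rightarrow> int \<Rightarrow> real" where
  "fejer_weight N n = max 0 (1 - \<bar>n\<bar> / Suc N)"

text \<open>The Cesaro mean of the partial sums of the formal series with coefficients
  \<open>c\<close>.\<close>

definition fejer :: "(int \<Rightarrow> complex) \<Rightarrow> nat \<Rightarrow> complex \<Rightarrow> complex" where
  "fejer c N z = (\<Sum>n\<in>{- int N..int N}. of_real (fejer_weight N n) * c n * z powi n)"

text \<open>By Parseval, the squared \<open>L^2\<close> norm of the Fejer mean. Written in terms of
  the coefficients, it is visibly measurable whenever they are.\<close>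

definition energy :: "(int \<Rightarrow> complex) \<Rightarrow> nat \<Rightarrow> real" where
  "energy c N = (\<Sum>n\<in>{- int N..int N}. (fejer_weight N n)\<^sup>2 * (norm (c n))\<^sup>2)"

lemma fejer_weight_nonneg: "0 \<le> fejer_weight N n"
  by (simp add: fejer_weight_def)

lemma fejer_weight_mono: "N \<le> M \<Longrightarrow> fejer_weight N n \<le> fejer_weight M n"
  unfolding fejer_weight_def
  by (intro max.mono diff_left_mono divide_left_mono) auto

lemma fejer_weight_eq_0: "n \<notin> {- int N..int N} \<Longrightarrow> fejer_weight N n = 0"
  by (auto simp: fejer_weight_def max_def field_simps)

lemma tendsto_fejer_weight: "(\<lambda>N. fejer_weight N n) \<longlonglongrightarrow> 1"
proof -
  have "(\<lambda>N. max 0 (1 - real_of_int \<bar>n\<bar> * inverse (real (Suc N)))) \<longlonglongrightarrow> max 0 (1 - real_of_int \<bar>n\<bar> * 0)"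
    by (intro tendsto_intros LIMSEQ_inverse_real_of_nat)
  then show ?thesis
    by (simp add: fejer_weight_def[abs_def] divide_inverse)
qed

lemma fejer_extend:
  assumes "N \<le> M"
  shows "fejer c N z = (\<Sum>n\<in>{- int M..int M}. of_real (fejer_weight N n) * c n * z powi n)"
  unfolding fejer_def using assms by (intro sum.mono_neutral_left) (auto simp: fejer_weight_eq_0)

lemma energy_extend:
  assumes "N \<le> M"
  shows "energy c N = (\<Sum>n\<in>{- int M..int M}. (fejer_weight N n)\<^sup>2 * (norm (c n))\<^sup>2)"
  unfolding energy_def using assms by (intro sum.mono_neutral_left) (auto simp: fejer_weight_eq_0)

lemma integral_norm_fejer: "(LINT z|circle. (norm (fejer c N z))\<^sup>2) = energy c N"
  unfolding fejer_def energy_def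
  by (subst integral_norm_powi_sum) (simp_all add: norm_mult power_mult_distrib)

lemma energy_mono: "N \<le> M \<Longrightarrow> energy c N \<le> energy c M"
  unfolding energy_extend[of N M]
  unfolding energy_def
  by (intro sum_mono mult_right_mono power_mono fejer_weight_mono fejer_weight_nonneg) auto

text \<open>The weights increase with \<open>N\<close>, and \<open>(b - a)\<^sup>2 \<le> b\<^sup>2 - a\<^sup>2\<close> for \<open>0 \<le> a \<le> b\<close>.\<close>

lemma integral_norm_fejer_diff:
  assumes "N \<le> M"
  shows "(LINT z|circle. (norm (fejer c M z - fejer c N z))\<^sup>2) \<le> energy c M - energy c N"
proof -
  let ?w = "\<lambda>n. fejer_weight M n - fejer_weight N n"
  have "fejer c M z - fejer c N z = (\<Sum>n\<in>{- int M..int M}. (of_real (?w n) * c n) * z powi n)" for z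
    unfolding fejer_extend[OF assms] unfolding fejer_def
    by (simp add: sum_subtractf[symmetric] algebra_simps)
  then have "(LINT z|circle. (norm (fejer c M z - fejer c N z))\<^sup>2)
      = (\<Sum>n\<in>{- int M..int M}. (?w n)\<^sup>2 * (norm (c n))\<^sup>2)"
    by (simp add: integral_norm_powi_sum norm_mult power_mult_distrib del: of_real_diff)
  also have "\<dots> \<le> (\<Sum>n\<in>{- int M..int M}. ((fejer_weight M n)\<^sup>2 - (fejer_weight N n)\<^sup>2) * (norm (c n))\<^sup>2)"
  proof (intro sum_mono mult_right_mono)
    fix n
    have "0 \<le> 2 * (fejer_weight N n * ?w n)"
      using fejer_weight_mono[OF assms, of n] fejer_weight_nonneg[of N n] by simp
    then show "(?w n)\<^sup>2 \<le> (fejer_weight M n)\<^sup>2 - (fejer_weight N n)\<^sup>2"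
      by (simp add: power2_eq_square algebra_simps)
  qed simp
  also have "\<dots> = energy c M - energy c N"
    unfolding energy_extend[OF assms] unfolding energy_def
    by (simp add: sum_subtractf[symmetric] algebra_simps)
  finally show ?thesis .
qed

lemma square_integrable_fejer: "square_integrable (fejer c N)"
  unfolding fejer_def[abs_def] by (rule square_integrable_powi_sum)

lemma integral_fejer_powi:
  "(LINT z|circle. fejer c N z * z powi (- m)) = of_real (fejer_weight N m) * c m"
  unfolding fejer_def by (subst integral_powi_sum_mult_powi) (auto simp: fejer_weight_eq_0)

text \<open>Unlike a subsequence obtained by choice, this index depends measurably on the sequence.\<close>

definition fast_index :: "(nat \<Rightarrow> real) \<Rightarrow> nat \<Rightarrow> nat" where
  "fast_index F k = (LEAST N. k \<le> N \<and> (\<forall>M\<ge>N. F M - F N \<le> (1/4) ^ k))"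

text \<open>A bounded increasing sequence converges to its supremum; once it is within
  \<open>(1/4) ^ k\<close> of it, later increments cannot exceed that amount. Hence the set whose
  least element is taken is nonempty.\<close>

lemma fast_index:
  assumes F: "mono F" "\<And>N. F N \<le> B"
  shows "k \<le> fast_index F k" "fast_index F k \<le> M \<Longrightarrow> F M - F (fast_index F k) \<le> (1/4) ^ k"
proof -
  obtain L where L: "F \<longlonglongrightarrow> L" "\<And>N. F N \<le> L"
    using incseq_convergent[of F B] F by auto
  have "\<forall>\<^sub>F N in sequentially. L - (1/4) ^ k < F N"
    by (rule order_tendstoD(1)[OF L(1)]) simp
  then obtain N0 where N0: "\<And>N. N \<ge> N0 \<Longrightarrow> L - (1/4) ^ k < F N"
    by (auto simp: eventually_sequentially)
  have "k \<le> max k N0 \<and> (\<forall>M\<ge>max k N0. F M - F (max k N0) \<le> (1/4) ^ k)"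
  proof (intro conjI allI impI)
    fix M
    show "F M - F (max k N0) \<le> (1/4) ^ k"
      using N0[of "max k N0"] L(2)[of M] by linarith
  qed simp
  from LeastI[of "\<lambda>N. k \<le> N \<and> (\<forall>M\<ge>N. F M - F N \<le> (1/4) ^ k)", OF this]
  show "k \<le> fast_index F k" "fast_index F k \<le> M \<Longrightarrow> F M - F (fast_index F k) \<le> (1/4) ^ k"
    unfolding fast_index_def by blast+
qed

text \<open>The default \<open>0\<close> gives the symbol a value at every point of the circle. The
  Cauchy test is a countable combination of inequalities between terms, hence measurable.\<close>

definition symbol :: "(int \<Rightarrow> complex) \<Rightarrow> complex \<Rightarrow> complex" where
  "symbol c z = (let s = (\<lambda>k. fejer c (fast_index (energy c) k) z) in if Cauchy s then lim s else 0)"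

lemma measurable_symbol:
  assumes c: "\<And>n. (\<lambda>\<omega>. c \<omega> n) \<in> borel_measurable M"
  shows "(\<lambda>(\<omega>, z). symbol (c \<omega>) z) \<in> borel_measurable (M \<Otimes>\<^sub>M circle)"
proof -
  note c [measurable]
  have "(\<lambda>x. energy (c (fst x)) N) \<in> borel_measurable (M \<Otimes>\<^sub>M circle)" for N
    unfolding energy_def by measurable
  \<comment> \<open>The least index satisfying countably many measurable conditions is
    measurable.\<close>
  then have [measurable]: "(\<lambda>x. fast_index (energy (c (fst x))) k) \<in> M \<Otimes>\<^sub>M circle \<rightarrow>\<^sub>M count_space UNIV" for k
    unfolding fast_index_def by measurable
  have [measurable]: "(\<lambda>x. snd x) \<in> borel_measurable (M \<Otimes>\<^sub>M circle)"
    using measurable_compose[OF measurable_snd measurable_ident_circle] .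
  have "(\<lambda>x. fejer (c (fst x)) N (snd x)) \<in> borel_measurable (M \<Otimes>\<^sub>M circle)" for N
    unfolding fejer_def by measurable
  \<comment> \<open>The index is itself random; the space splits into the countably many sets on
    which it is constant.\<close>
  then have [measurable]: "(\<lambda>x. fejer (c (fst x)) (fast_index (energy (c (fst x))) k) (snd x))
      \<in> borel_measurable (M \<Otimes>\<^sub>M circle)" for k
    by (rule measurable_compose_countable) measurable
  show ?thesis
    unfolding symbol_def Let_def case_prod_beta by measurable
qed

section \<open>The symbol when the Fejer means are uniformly bounded\<close>

context
  fixes c :: "int \<Rightarrow> complex" and B :: real
  assumes fejer_le: "\<And>N z. z \<in> sphere 0 1 \<Longrightarrow> norm (fejer c N z) \<le> B"
begin

lemma fejer_bound_nonneg: "0 \<le> B"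
  using fejer_le[of 1 0] norm_ge_zero[of "fejer c 0 1"] by (simp del: norm_ge_zero)

lemma energy_le: "energy c N \<le> B\<^sup>2"
proof -
  have "(LINT z|circle. (norm (fejer c N z))\<^sup>2) \<le> (LINT z|circle. B\<^sup>2)"
    by (intro integral_mono square_integrableD(2)[OF square_integrable_fejer])
       (auto intro!: power_mono fejer_le)
  then show ?thesis
    using circle.prob_space by (simp add: integral_norm_fejer)
qed

lemma AE_symbol:
  "AE z in circle. (\<lambda>k. fejer c (fast_index (energy c) k) z) \<longlonglongrightarrow> symbol c z"
proof -
  let ?N = "fast_index (energy c)"
  have mono: "mono (energy c)"
    by (rule monoI) (rule energy_mono)
  note idx = fast_index[OF mono energy_le]
  \<comment> \<open>Whichever of the two indices is smaller supplies the bound: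
    \<open>(1/4) ^ k\<close> in the first case, \<open>(1/4) ^ Suc k\<close> in the second.\<close>
  have "(LINT z|circle. (norm (fejer c (?N (Suc k)) z - fejer c (?N k) z))\<^sup>2) \<le> (1/4) ^ k" for k
  proof (cases "?N k \<le> ?N (Suc k)")
    case True
    show ?thesis
      using integral_norm_fejer_diff[OF True, of c] idx(2)[OF True] by linarith
  next
    case False
    then have le: "?N (Suc k) \<le> ?N k" by simp
    have "(1/4 :: real) ^ Suc k \<le> (1/4) ^ k"
      by (rule power_decreasing) auto
    then show ?thesis
      using integral_norm_fejer_diff[OF le, of c] idx(2)[OF le]
      by (simp only: norm_minus_commute[of "fejer c (?N (Suc k)) _"])
  qed
  then have "AE z in circle. convergent (\<lambda>k. fejer c (?N k) z)"
    by (intro circle.AE_convergent_of_fast_Cauchy_L2 square_integrableD square_integrable_diff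
        square_integrable_fejer)
  then show ?thesis
  proof eventually_elim
    case (elim z)
    then show ?case
      by (simp only: symbol_def Let_def convergent_Cauchy if_True convergent_LIMSEQ_iff[symmetric])
  qed
qed

text \<open>Boundedness is required at every point and not just almost everywhere. Limits inherit it
  from the Fejer means, and the default value satisfies it because \<open>B\<close> is
  nonnegative.\<close>

lemma norm_symbol_le:
  assumes "z \<in> sphere 0 1"
  shows "norm (symbol c z) \<le> B"
proof (cases "Cauchy (\<lambda>k. fejer c (fast_index (energy c) k) z)")
  case True
  then have "(\<lambda>k. fejer c (fast_index (energy c) k) z) \<longlonglongrightarrow> symbol c z"
    by (simp only: symbol_def Let_def if_True Cauchy_convergent_iff convergent_LIMSEQ_iff[symmetric])
  then show ?thesis
    by (rule tendsto_upperbound[OF tendsto_norm]) (auto intro!: always_eventually fejer_le assms)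
next
  case False
  then show ?thesis
    by (simp add: symbol_def fejer_bound_nonneg)
qed

text \<open>The deterministic case of joint measurability, taken over the one-point space
  \<open>unit\<close>.\<close>

lemma symbol_measurable_circle: "symbol c \<in> borel_measurable circle"
  using measurable_compose_Pair1[OF _ measurable_symbol[of "\<lambda>_::unit. c" "count_space UNIV"], of "()"]
  by simp

lemma bounded_symbol: "bounded (symbol c ` space circle)"
  unfolding bounded_iff space_circle using norm_symbol_le by blast

text \<open>Dominated convergence with the constant majorant \<open>B\<close>; the coefficients of
  the Fejer means tend to \<open>c m\<close> because the weights tend to \<open>1\<close>.\<close>

lemma integral_symbol_powi: "(LINT z|circle. symbol c z * z powi (- m)) = c m"
proof -
  let ?N = "fast_index (energy c)"
  have mono: "mono (energy c)"
    by (rule monoI) (rule energy_mono)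
  have [measurable]: "fejer c N \<in> borel_measurable circle" for N
    by (rule square_integrableD(1)[OF square_integrable_fejer])
  have powi: "(\<lambda>z. z powi (- m)) \<in> borel_measurable circle"
    by (rule measurable_powi[OF measurable_ident_circle])
  have "(\<lambda>k. LINT z|circle. fejer c (?N k) z * z powi (- m)) \<longlonglongrightarrow> (LINT z|circle. symbol c z * z powi (- m))"
  proof (rule integral_dominated_convergence[where w="\<lambda>_. B"])
    show "AE z in circle. (\<lambda>k. fejer c (?N k) z * z powi (- m)) \<longlonglongrightarrow> symbol c z * z powi (- m)"
      using AE_symbol by eventually_elim (rule tendsto_mult_right)
    show "AE z in circle. norm (fejer c (?N k) z * z powi (- m)) \<le> B" for k
    proof (rule AE_I2)
      fix z assume "z \<in> space circle"
      then show "norm (fejer c (?N k) z * z powi (- m)) \<le> B"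
        using fejer_le[of z "?N k"] norm_powi_circle[of z "- m"] by (simp only: norm_mult space_circle mult_1_right)
    qed
    show "(\<lambda>z. fejer c (?N k) z * z powi (- m)) \<in> borel_measurable circle" for k
      by (rule borel_measurable_times[OF _ powi]) measurable
    show "(\<lambda>z. symbol c z * z powi (- m)) \<in> borel_measurable circle"
      by (rule borel_measurable_times[OF symbol_measurable_circle powi])
  qed simp
  then have "(\<lambda>k. of_real (fejer_weight (?N k) m) * c m) \<longlonglongrightarrow> (LINT z|circle. symbol c z * z powi (- m))"
    by (simp only: integral_fejer_powi)
  \<comment> \<open>The clause \<open>k \<le> N\<close> in \<open>fast_index\<close> ensures that
    the chosen indices tend to infinity.\<close>
  moreover have "filterlim ?N at_top sequentially"
    using fast_index(1)[OF mono energy_le]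
    by (intro filterlim_at_top_mono[OF filterlim_ident] always_eventually allI)
  then have "(\<lambda>k. of_real (fejer_weight (?N k) m) * c m) \<longlonglongrightarrow> of_real 1 * c m"
    by (intro tendsto_mult_right tendsto_of_real filterlim_compose[OF tendsto_fejer_weight])
  ultimately show ?thesis
    using LIMSEQ_unique by fastforce
qed

end

section \<open>Fejer means as quadratic forms\<close>

lemma sum_weight_extend:
  fixes g :: "int \<Rightarrow> complex"
  shows "(\<Sum>n\<in>{- int N..int N}. of_int (int (Suc N) - \<bar>n\<bar>) * g n)
    = (\<Sum>n\<in>{- int (Suc N)..int (Suc N)}. of_int (int (Suc N) - \<bar>n\<bar>) * g n)"
proof (rule sum.mono_neutral_left)
  show "\<forall>n\<in>{- int (Suc N)..int (Suc N)} - {- int N..int N}. of_int (int (Suc N) - \<bar>n\<bar>) * g n = 0"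
  proof
    fix n assume "n \<in> {- int (Suc N)..int (Suc N)} - {- int N..int N}"
    \<comment> \<open>Only the two indices of absolute value \<open>Suc N\<close> are new, and their
      weight is zero.\<close>
    then have "int (Suc N) - \<bar>n\<bar> = 0"
      by auto
    then show "of_int (int (Suc N) - \<bar>n\<bar>) * g n = 0"
      by (simp only: of_int_0 mult_zero_left)
  qed
qed auto

text \<open>In an \<open>N\<close> by \<open>N\<close> square the diagonal \<open>i - j = n\<close>
  has \<open>N - \<bar>n\<bar>\<close> entries. In the induction, the added row and column meet each
  diagonal from \<open>- N\<close> to \<open>N\<close> exactly once.\<close>

lemma sum_int_diff:
  fixes g :: "int \<Rightarrow> complex"
  shows "(\<Sum>i<N. \<Sum>j<N. g (int i - int j)) = (\<Sum>n\<in>{- int N..int N}. of_int (int N - \<bar>n\<bar>) * g n)"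
proof (induction N)
  case (Suc N)
  have "(\<Sum>i<Suc N. \<Sum>j<Suc N. g (int i - int j)) =
      (\<Sum>i<N. \<Sum>j<N. g (int i - int j)) + ((\<Sum>i<N. g (int i - int N)) + (\<Sum>j\<le>N. g (int N - int j)))"
    by (simp add: sum.distrib lessThan_Suc_atMost[symmetric])
  \<comment> \<open>The new column covers the negative diagonals; the new row, with the corner,
    covers the others.\<close>
  also have "(\<Sum>i<N. g (int i - int N)) = (\<Sum>n\<in>{- int N..<0}. g n)"
    by (rule sum.reindex_bij_witness[where i="\<lambda>n. nat (n + int N)" and j="\<lambda>i. int i - int N"]) auto
  also have "(\<Sum>j\<le>N. g (int N - int j)) = (\<Sum>n\<in>{0..int N}. g n)"
    by (rule sum.reindex_bij_witness[where i="\<lambda>n. nat (int N - n)" and j="\<lambda>j. int N - int j"]) auto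
  also have "(\<Sum>n\<in>{- int N..<0}. g n) + (\<Sum>n\<in>{0..int N}. g n) = (\<Sum>n\<in>{- int N..int N}. g n)"
    by (subst sum.union_disjoint[symmetric]) (auto intro!: sum.cong)
  also have "(\<Sum>i<N. \<Sum>j<N. g (int i - int j)) + \<dots>
      = (\<Sum>n\<in>{- int N..int N}. of_int (int (Suc N) - \<bar>n\<bar>) * g n)"
    unfolding Suc.IH by (simp add: sum.distrib[symmetric] algebra_simps)
  also have "\<dots> = (\<Sum>n\<in>{- int (Suc N)..int (Suc N)}. of_int (int (Suc N) - \<bar>n\<bar>) * g n)"
    by (rule sum_weight_extend)
  finally show ?case .
qed simp

text \<open>The factor \<open>Suc N\<close> turns each weight into the length of a diagonal in a
  square of side \<open>Suc N\<close>.\<close>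

lemma fejer_double_sum:
  assumes z: "z \<in> sphere 0 1"
  shows "of_nat (Suc N) * fejer c N z
    = (\<Sum>i<Suc N. \<Sum>j<Suc N. c (int i - int j) * z powi (int i - int j))"
proof -
  have w: "real (Suc N) * fejer_weight N n = int (Suc N) - \<bar>n\<bar>" if "n \<in> {- int N..int N}" for n
  proof -
    have "real_of_int \<bar>n\<bar> / real (Suc N) \<le> 1"
      using that by auto
    then have "fejer_weight N n = 1 - real_of_int \<bar>n\<bar> / real (Suc N)"
      by (simp add: fejer_weight_def)
    then show ?thesis
      by (simp add: right_diff_distrib del: of_nat_Suc)
  qed
  have "of_nat (Suc N) * fejer c N z
      = (\<Sum>n\<in>{- int N..int N}. of_real (real (Suc N) * fejer_weight N n) * (c n * z powi n))"
    by (simp add: fejer_def sum_distrib_left mult_ac)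
  also have "\<dots> = (\<Sum>n\<in>{- int N..int N}. of_int (int (Suc N) - \<bar>n\<bar>) * (c n * z powi n))"
    by (intro sum.cong refl) (simp only: w of_real_of_int_eq)
  also have "\<dots> = (\<Sum>n\<in>{- int (Suc N)..int (Suc N)}. of_int (int (Suc N) - \<bar>n\<bar>) * (c n * z powi n))"
    by (rule sum_weight_extend)
  finally show ?thesis
    by (simp only: sum_int_diff[of "\<lambda>n. c n * z powi n"])
qed

text \<open>
  A Fejer mean at \<open>z\<close> is the quadratic form of the operator at the normalised vector with
  coordinates \<open>z powi (- j)\<close>, \<open>j \<le> N\<close>.
\<close>

lemma norm_fejer_le_of_bounded_operator:
  assumes T: "T \<in> bounded_operators H2"
    and coeff: "\<And>i j. matrix_coeff T i j = c (int i - int j)"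
  obtains K where "\<And>N z. z \<in> sphere 0 1 \<Longrightarrow> norm (fejer c N z) \<le> K"
proof -
  have T_add: "\<And>u v. u \<in> H2 \<Longrightarrow> v \<in> H2 \<Longrightarrow> T (u + v) = T u + T v"
    and T_scale: "\<And>c u. u \<in> H2 \<Longrightarrow> T (scaleC_L2 c u) = scaleC_L2 c (T u)"
    and "\<exists>K. \<forall>u\<in>H2. norm (T u) \<le> K * norm u"
    using T by (simp_all add: bounded_operators_def)
  then obtain K where "\<forall>u\<in>H2. norm (T u) \<le> K * norm u" by blast
  then have T_le: "\<And>u. u \<in> H2 \<Longrightarrow> norm (T u) \<le> K * norm u"
    by blast
  have "norm (fejer c N z) \<le> K" if z: "z \<in> sphere 0 1" for N z
  proof -
    \<comment> \<open>The vector is left unnormalised; its squared norm \<open>Suc N\<close> cancels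
      at the end.\<close>
    define k where "k F = (\<Sum>j\<in>F. scaleC_L2 (z powi (- int j)) (basis_L2 j))" for F
    have kH: "k F \<in> H2" for F
      unfolding k_def
      by (intro L2.subspace_sum[OF subspace_H2] L2.subspace_scale[OF subspace_H2] basis_in_H2)
    have T_k: "T (k F) = (\<Sum>j\<in>F. scaleC_L2 (z powi (- int j)) (T (basis_L2 j)))" if "finite F" for F
      using that
    proof (induction F)
      case empty
      then show ?case
        using T_scale[of 0 0] L2.subspace_0[OF subspace_H2] by (simp add: k_def)
    next
      case (insert j F)
      have "k (insert j F) = scaleC_L2 (z powi (- int j)) (basis_L2 j) + k F"
        using insert.hyps by (simp add: k_def)
      then show ?case
        using insert T_add[OF L2.subspace_scale[OF subspace_H2 basis_in_H2] kH] T_scale[OF basis_in_H2]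
        by simp
    qed
    \<comment> \<open>The second argument is conjugated, which turns \<open>z powi (- int i)\<close>
      into \<open>z powi int i\<close>.\<close>
    have "cinner (T (k {..<Suc N})) (k {..<Suc N})
      = (\<Sum>i<Suc N. \<Sum>j<Suc N. z powi int i * (z powi (- int j) * c (int i - int j)))"
      unfolding T_k[OF finite_lessThan]
      unfolding k_def cinner_sum_left cinner_sum_right
      unfolding cinner_scaleC_left cinner_scaleC_right cnj_powi_circle[OF z] minus_minus
      by (simp only: coeff matrix_coeff_def[symmetric])
    also have "\<dots> = (\<Sum>i<Suc N. \<Sum>j<Suc N. c (int i - int j) * z powi (int i - int j))"
    proof (intro sum.cong refl)
      fix i j
      have "z powi (int i - int j) = z powi int i * z powi (- int j)"
        by (simp only: powi_add_circle[OF z] diff_conv_add_uminus)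
      then show "z powi int i * (z powi (- int j) * c (int i - int j)) = c (int i - int j) * z powi (int i - int j)"
        by (simp only: mult_ac)
    qed
    also have "\<dots> = of_nat (Suc N) * fejer c N z"
      by (rule fejer_double_sum[OF z, symmetric])
    finally have "of_nat (Suc N) * fejer c N z = cinner (T (k {..<Suc N})) (k {..<Suc N})" ..
    then have "real (Suc N) * norm (fejer c N z) = norm (cinner (T (k {..<Suc N})) (k {..<Suc N}))"
      by (metis norm_mult norm_of_nat)
    also have "\<dots> \<le> norm (T (k {..<Suc N})) * norm (k {..<Suc N})"
      by (rule norm_cinner_le)
    also have "\<dots> \<le> K * norm (k {..<Suc N}) * norm (k {..<Suc N})"
      by (intro mult_right_mono T_le kH norm_ge_zero)
    also have "\<dots> = K * (norm (k {..<Suc N}))\<^sup>2"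
      by (simp add: power2_eq_square)
    also have "(norm (k {..<Suc N}))\<^sup>2 = real (Suc N)"
      unfolding k_def by (simp only: norm_basis_sum finite_lessThan norm_powi_circle[OF z]) simp
    finally have "real (Suc N) * norm (fejer c N z) \<le> real (Suc N) * K"
      by (simp only: mult.commute)
    then show ?thesis
      by (simp only: mult_le_cancel_left_pos of_nat_0_less_iff zero_less_Suc)
  qed
  then show ?thesis by (rule that)
qed

section \<open>Toeplitz symbols and constancy along diagonals\<close>

theorem theorem18:
  fixes M :: "'w measure" and A :: "'w \<Rightarrow> circle_L2 \<Rightarrow> circle_L2"
  assumes "prob_space M" and "random_operator M H2 A"
  shows "random_toeplitz M A \<longleftrightarrow>
    (\<forall>\<omega>\<in>space M. \<forall>i j. matrix_coeff (A \<omega>) (i + 1) (j + 1) = matrix_coeff (A \<omega>) i j)"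
proof
  assume "random_toeplitz M A"
  then obtain \<phi> :: "'w \<Rightarrow> complex \<Rightarrow> complex"
    where \<phi>: "case_prod \<phi> \<in> borel_measurable (M \<Otimes>\<^sub>M circle)"
      "\<forall>\<omega>\<in>space M. bounded (\<phi> \<omega> ` space circle)"
      "\<forall>\<omega>\<in>space M. \<forall>u\<in>H2. A \<omega> u = toeplitz (\<phi> \<omega>) u"
    unfolding random_toeplitz_def by blast
  show "\<forall>\<omega>\<in>space M. \<forall>i j. matrix_coeff (A \<omega>) (i + 1) (j + 1) = matrix_coeff (A \<omega>) i j"
  proof (intro ballI allI)
    fix \<omega> i j assume \<omega>: "\<omega> \<in> space M"
    \<comment> \<open>Sections of a product-measurable function are measurable.\<close>
    have "\<phi> \<omega> \<in> borel_measurable circle"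
      using measurable_compose_Pair1[OF \<omega> \<phi>(1)] by simp
    moreover have "bounded (\<phi> \<omega> ` space circle)"
      using \<phi>(2) \<omega> by blast
    ultimately have "matrix_coeff (toeplitz (\<phi> \<omega>)) i j
        = (LINT z|circle. \<phi> \<omega> z * z powi (int j - int i))" for i j
      by (rule matrix_coeff_toeplitz)
    moreover have "matrix_coeff (A \<omega>) i j = matrix_coeff (toeplitz (\<phi> \<omega>)) i j" for i j
      using \<phi>(3) \<omega> by (simp add: matrix_coeff_def)
    ultimately show "matrix_coeff (A \<omega>) (i + 1) (j + 1) = matrix_coeff (A \<omega>) i j"
      by simp
  qed
next
  assume shift: "\<forall>\<omega>\<in>space M. \<forall>i j. matrix_coeff (A \<omega>) (i + 1) (j + 1) = matrix_coeff (A \<omega>) i j"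
  \<comment> \<open>Entries of the first column and first row: \<open>nat\<close> truncates at zero,
    so one of the two indices is \<open>0\<close> and the other is
    \<open>\<bar>n\<bar>\<close>.\<close>
  define c where "c \<omega> n = matrix_coeff (A \<omega>) (nat n) (nat (- n))" for \<omega> n
  have A: "A \<omega> \<in> bounded_operators H2" if "\<omega> \<in> space M" for \<omega>
    using assms(2) that by (simp add: random_operator_def)
  have coeff: "matrix_coeff (A \<omega>) i j = c \<omega> (int i - int j)" if \<omega>: "\<omega> \<in> space M" for \<omega> i j
  proof -
    have "matrix_coeff (A \<omega>) (i + d) (j + d) = matrix_coeff (A \<omega>) i j" for i j d
      using shift \<omega> by (induction d) simp_all
    \<comment> \<open>Truncated subtraction makes \<open>(i - j, j - i)\<close> the start of the
      diagonal through \<open>(i, j)\<close>, reached from it in \<open>min i j\<close>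
      shifts.\<close>
    from this[of "i - j" "min i j" "j - i"] this[of "i - j" "j - i" "min i j"] show ?thesis
      by (simp add: c_def min_def nat_diff_distrib split: if_splits)
  qed
  have "(\<lambda>\<omega>. c \<omega> n) \<in> borel_measurable M" for n
    using assms(2) by (simp add: c_def matrix_coeff_def random_operator_def)
  then have "case_prod (\<lambda>\<omega>. symbol (c \<omega>)) \<in> borel_measurable (M \<Otimes>\<^sub>M circle)"
    by (rule measurable_symbol)
  moreover have "bounded (symbol (c \<omega>) ` space circle) \<and> (\<forall>u\<in>H2. A \<omega> u = toeplitz (symbol (c \<omega>)) u)"
    if \<omega>: "\<omega> \<in> space M" for \<omega>
  proof -
    \<comment> \<open>The constant may vary with \<omega>: it enters only statements at fixed
      \<omega>, while the symbol is defined from the coefficients alone.\<close>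
    obtain K where K: "\<And>N z. z \<in> sphere 0 1 \<Longrightarrow> norm (fejer (c \<omega>) N z) \<le> K"
      using norm_fejer_le_of_bounded_operator[OF A[OF \<omega>] coeff[OF \<omega>]] by blast
    have b: "bounded (symbol (c \<omega>) ` space circle)"
      using K by (rule bounded_symbol)
    have "matrix_coeff (A \<omega>) i j = (LINT z|circle. symbol (c \<omega>) z * z powi (int j - int i))" for i j
      using integral_symbol_powi[OF K, of "int i - int j"] coeff[OF \<omega>, of i j] by simp
    with b symbol_measurable_circle[OF K] A[OF \<omega>] show ?thesis
      using toeplitz_eqI by metis
  qed
  ultimately show "random_toeplitz M A"
    unfolding random_toeplitz_def by blast
qed

end
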